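(* Let $X\subset\mathbb{R}^2$ be a generic smooth closed convex curve with nowhere vanishing curvature. Then the set of orthotricenters of $X$ is a compact subset of the interior region of the caustic $C(X)$ and coincides with the core of the caustic.
   Context: An orthotripod on $X$ is an unordered triple of distinct points of $X$ such that the normal lines to $X$ at these three points are concurrent; the common point of these three normals is called its orthotricenter. The caustic (evolute) $C(X)$ is the set of curvature centers at all points of $X$. Generic means that $C(X)$ is a piecewise smooth curve whose only singularities are cusps and normal crossings. The caustic divides the plane into closed domains (the closures of the connected components of $\mathbb{R}^2\setminus C(X)$). For $Q\in\mathbb{R}^2$, let $n(Q)$ be the number of normals to $X$ emerging from $Q$, i.e. the number of points $P\in X$ such that the normal line to $X$ at $P$ contains $Q$; $n$ is constant on the interior of each of the domains, and equals $2$ on the non-compact domain. The interior region of the caustic is the union of the compact domains. The core of the caustic is the union of those closed domains whose (interior) points have at least four emerging normals.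
   Formalization: Cusps of the core may carry only two normals (e.g. those of an ellipse's caustic), so the orthotricenters need not be compact; proved instead: their closure is compact, lies in the interior region and equals the core, and the set itself equals the core away from the cusps of the caustic. *)

theory Defs
  imports "HOL-Analysis.Analysis"
begin

section \<open>Smooth maps\<close>

definition dir_deriv ::
  "'a::euclidean_space \<Rightarrow> ('a \<Rightarrow> 'b::euclidean_space) \<Rightarrow> 'a \<Rightarrow> 'b" where
  "dir_deriv v f = (\<lambda>x. frechet_derivative f (at x) v)"

text \<open>\<open>C\<^sup>\<infinity>\<close>: all iterated directional derivatives exist and are differentiable. Only meant
  for open \<open>U\<close>.\<close>

definition smooth_on ::
  "'a::euclidean_space set \<Rightarrow> ('a \<Rightarrow> 'b::euclidean_space) \<Rightarrow> bool" where
  "smooth_on U f \<longleftrightarrow> (\<forall>vs. foldr dir_deriv vs f differentiable_on U)"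


section \<open>Closed convex plane curves\<close>

text \<open>A curve \<open>X\<close> is given by a periodic parametrization \<open>\<gamma>\<close> on the whole real line, with
  \<open>X = range \<gamma>\<close>. The period is arbitrary, and \<open>\<gamma>\<close> is injective modulo the period.\<close>

definition smooth_closed_curve :: "(real \<Rightarrow> real^2) \<Rightarrow> bool" where
  "smooth_closed_curve \<gamma> \<longleftrightarrow>
     smooth_on UNIV \<gamma> \<and>
     (\<forall>t. vector_derivative \<gamma> (at t) \<noteq> 0) \<and>
     (\<exists>T>0. \<forall>s t. \<gamma> s = \<gamma> t \<longleftrightarrow> (\<exists>k::int. t - s = of_int k * T))"

definition convex_curve :: "(real \<Rightarrow> real^2) \<Rightarrow> bool" where
  "convex_curve \<gamma> \<longleftrightarrow> range \<gamma> = frontier (convex hull (range \<gamma>))"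

definition rot90 :: "real^2 \<Rightarrow> real^2" where
  "rot90 v = vector [- (v $ 2), v $ 1]"

definition curvature :: "(real \<Rightarrow> real^2) \<Rightarrow> real \<Rightarrow> real" where
  "curvature \<gamma> t =
     (let v = vector_derivative \<gamma> (at t);
          a = vector_derivative (\<lambda>s. vector_derivative \<gamma> (at s)) (at t)
      in (rot90 v \<bullet> a) / norm v ^ 3)"

definition curvature_center :: "(real \<Rightarrow> real^2) \<Rightarrow> real \<Rightarrow> real^2" where
  "curvature_center \<gamma> t =
     (let v = vector_derivative \<gamma> (at t)
      in \<gamma> t + (1 / curvature \<gamma> t) *\<^sub>R (rot90 v /\<^sub>R norm v))"


section \<open>Normals and orthotripods\<close>

definition normal_line :: "(real \<Rightarrow> real^2) \<Rightarrow> real^2 \<Rightarrow> (real^2) set" where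
  "normal_line \<gamma> P = {Q. \<exists>t. \<gamma> t = P \<and> (Q - P) \<bullet> vector_derivative \<gamma> (at t) = 0}"

text \<open>The value is the junk value \<open>0\<close> when infinitely many normals pass through \<open>Q\<close>. This can
  only happen for \<open>Q\<close> on the caustic, where the number of normals is never used.\<close>

definition num_normals :: "(real \<Rightarrow> real^2) \<Rightarrow> real^2 \<Rightarrow> nat" where
  "num_normals \<gamma> Q = card {P \<in> range \<gamma>. Q \<in> normal_line \<gamma> P}"

definition orthotripod :: "(real \<Rightarrow> real^2) \<Rightarrow> (real^2) set \<Rightarrow> bool" where
  "orthotripod \<gamma> S \<longleftrightarrow>
     S \<subseteq> range \<gamma> \<and> card S = 3 \<and> (\<Inter>P\<in>S. normal_line \<gamma> P) \<noteq> {}"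

definition orthotricenters :: "(real \<Rightarrow> real^2) \<Rightarrow> (real^2) set" where
  "orthotricenters \<gamma> = {Q. \<exists>S. orthotripod \<gamma> S \<and> Q \<in> (\<Inter>P\<in>S. normal_line \<gamma> P)}"


section \<open>The caustic\<close>

definition caustic :: "(real \<Rightarrow> real^2) \<Rightarrow> (real^2) set" where
  "caustic \<gamma> = range (curvature_center \<gamma>)"

text \<open>Near \<open>Q\<close>, the set \<open>C\<close> is carried to the model \<open>M\<close> near the origin by a smooth local
  diffeomorphism of the plane sending \<open>Q\<close> to the origin.\<close>

definition locally_modelled_on :: "(real^2) set \<Rightarrow> (real^2) set \<Rightarrow> real^2 \<Rightarrow> bool" where
  "locally_modelled_on M C Q \<longleftrightarrow>
     (\<exists>U V \<phi> \<psi>. open U \<and> Q \<in> U \<and> open V \<and> 0 \<in> V \<and>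
        homeomorphism U V \<phi> \<psi> \<and> smooth_on U \<phi> \<and> smooth_on V \<psi> \<and>
        \<phi> Q = 0 \<and> \<phi> ` (C \<inter> U) = M \<inter> V)"

definition regular_point :: "(real^2) set \<Rightarrow> real^2 \<Rightarrow> bool" where
  "regular_point = locally_modelled_on {p. p $ 2 = 0}"

definition cusp :: "(real^2) set \<Rightarrow> real^2 \<Rightarrow> bool" where
  "cusp = locally_modelled_on {p. (p $ 2)^2 = (p $ 1)^3}"

definition normal_crossing :: "(real^2) set \<Rightarrow> real^2 \<Rightarrow> bool" where
  "normal_crossing = locally_modelled_on {p. p $ 1 * p $ 2 = 0}"

definition generic_curve :: "(real \<Rightarrow> real^2) \<Rightarrow> bool" where
  "generic_curve \<gamma> \<longleftrightarrow>
     (\<forall>Q\<in>caustic \<gamma>. regular_point (caustic \<gamma>) Q \<or> cusp (caustic \<gamma>) Q \<or>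
                      normal_crossing (caustic \<gamma>) Q)"

definition caustic_cusps :: "(real \<Rightarrow> real^2) \<Rightarrow> (real^2) set" where
  "caustic_cusps \<gamma> = {Q \<in> caustic \<gamma>. cusp (caustic \<gamma>) Q}"

definition closed_domains :: "(real \<Rightarrow> real^2) \<Rightarrow> (real^2) set set" where
  "closed_domains \<gamma> = closure ` components (- caustic \<gamma>)"

definition interior_region :: "(real \<Rightarrow> real^2) \<Rightarrow> (real^2) set" where
  "interior_region \<gamma> = \<Union>{E \<in> closed_domains \<gamma>. compact E}"

text \<open>The points at which normals are counted are those of the open component \<open>D\<close>.\<close>

definition core :: "(real \<Rightarrow> real^2) \<Rightarrow> (real^2) set" where
  "core \<gamma> = \<Union>{closure D | D. D \<in> components (- caustic \<gamma>) \<and> (\<forall>Q\<in>D. num_normals \<gamma> Q \<ge> 4)}"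

text \<open>At an ordinary cusp of the caustic three normals coalesce into one. A cusp on the border
  between domains with two and four normals (each of the four cusps of the evolute of an ellipse
  is one) therefore lies in the core, but only two points of the curve have their normals through
  it, so it is the center of no triple of distinct points. It is the limit of such centers, i.e.
  the center of a degenerate orthotripod. For this reason the set of orthotricenters is compared
  with the core both after taking its closure, and pointwise outside the cusps.\<close>

end

theory Submission
  imports Defs
begin

text \<open>Normals through \<open>Q\<close> correspond to zeros of \<open>F t = (Q - \<gamma> t) \<bullet> \<gamma>' t\<close>, and \<open>Q\<close> is on the
  caustic iff \<open>F\<close> has a double zero. As \<open>F\<close> is the derivative of a periodic function, it takes both
  signs, so two of any three zeros \<open>a\<close>, \<open>b\<close> lie consecutively between points of opposite sign. Unit
  tangents of a convex curve at distinct points are distinct, so moving \<open>Q\<close> slightly in the direction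
  of their difference at \<open>a\<close> and \<open>b\<close> makes \<open>F\<close> alternate in sign at four points. Hence every
  orthotricenter is a limit of points off the caustic with four normals. Off the caustic, having four
  normals is an open and closed condition, and such points form a bounded set. Finally, a point of the
  caustic that is not a cusp is an orthotricenter: at a regular parameter of the evolute \<open>F\<close> has a
  local extremum of value \<open>0\<close> and therefore two more zeros; where the evolute is locally constant,
  \<open>F\<close> vanishes on an interval; any other stationary parameter would force the differential of a
  chart to degenerate, because the tangent of the evolute keeps turning.\<close>

section \<open>Plane vectors\<close>

lemma inner_vec2: "(u::real^2) \<bullet> v = u $ 1 * v $ 1 + u $ 2 * v $ 2"
  by (simp add: inner_vec_def sum_2)

lemma rot90_nth [simp]: "rot90 v $ 1 = - (v $ 2)" "rot90 v $ 2 = v $ 1"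
  by (simp_all add: rot90_def vector_2)

lemma linear_rot90: "linear rot90"
  by (rule linearI) (simp_all add: vec_eq_iff forall_2)

lemma bounded_linear_rot90: "bounded_linear rot90"
  using linear_rot90 by (simp add: linear_conv_bounded_linear)

lemma rot90_inner_self [simp]: "rot90 v \<bullet> v = 0" "v \<bullet> rot90 v = 0"
  by (simp_all add: inner_vec2)

lemma rot90_inner_rot90 [simp]: "rot90 v \<bullet> rot90 w = v \<bullet> w"
  by (simp add: inner_vec2)

lemma rot90_scaleR: "rot90 (r *\<^sub>R v) = r *\<^sub>R rot90 v"
  by (simp add: vec_eq_iff forall_2)

lemma rot90_eq_0_iff [simp]: "rot90 v = 0 \<longleftrightarrow> v = 0"
  by (auto simp: vec_eq_iff forall_2)

lemma rot90_0 [simp]: "rot90 0 = 0"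
  by simp

lemma orthogonal_imp_multiple_rot90:
  assumes "u \<bullet> v = 0" "v \<noteq> 0"
  obtains q where "u = q *\<^sub>R rot90 v"
proof -
  have n: "v \<bullet> v \<noteq> 0" using assms by simp
  have o: "u $ 1 * v $ 1 + u $ 2 * v $ 2 = 0" using assms by (simp add: inner_vec2)
  \<comment> \<open>Expansion of \<open>u\<close> in the orthogonal basis \<open>v\<close>,
    \<open>rot90 v\<close>, multiplied by the squared length of \<open>v\<close>; the component
    along \<open>v\<close> vanishes.\<close>
  have "(v \<bullet> v) *\<^sub>R u = (u \<bullet> rot90 v) *\<^sub>R rot90 v"
  proof -
    have "(v $ 1 * v $ 1 + v $ 2 * v $ 2) * u $ 1 = - (v $ 2 * (u $ 2 * v $ 1 - u $ 1 * v $ 2))"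
      using o by algebra
    moreover have "(v $ 1 * v $ 1 + v $ 2 * v $ 2) * u $ 2 = v $ 1 * (u $ 2 * v $ 1 - u $ 1 * v $ 2)"
      using o by algebra
    ultimately show ?thesis
      by (simp add: vec_eq_iff forall_2 inner_vec2 algebra_simps)
  qed
  then have "u = ((u \<bullet> rot90 v) / (v \<bullet> v)) *\<^sub>R rot90 v"
    using n by (metis (no_types) eq_vector_fraction_iff)
  then show ?thesis using that by blast
qed

lemma orthogonal_two_imp_0:
  assumes "u \<bullet> v = 0" "u \<bullet> w = 0" "rot90 v \<bullet> w \<noteq> 0"
  shows "u = 0"
proof -
  have "v \<noteq> 0" using assms(3) by auto
  then obtain q where "u = q *\<^sub>R rot90 v" using orthogonal_imp_multiple_rot90 assms(1) by blast
  then show ?thesis using assms by simp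
qed

text \<open>Distinct unit vectors have inner product below 1. Applied to two tangents, this gives a
  displacement of \<open>Q\<close> that changes \<open>normal_fn\<close> with opposite signs at the
  two parameters.\<close>

lemma sgn_diff_inner:
  fixes v w :: "'a::real_inner"
  assumes "v \<noteq> 0" "w \<noteq> 0" "sgn v \<noteq> sgn w"
  shows "(sgn w - sgn v) \<bullet> w > 0" "(sgn w - sgn v) \<bullet> v < 0"
proof -
  have n: "sgn v \<bullet> sgn v = 1" "sgn w \<bullet> sgn w = 1"
    using assms by (simp_all add: dot_square_norm norm_sgn)
  have "0 < (sgn v - sgn w) \<bullet> (sgn v - sgn w)" using assms by (simp del: inner_diff_left inner_diff_right)
  then have s: "sgn v \<bullet> sgn w < 1"
    unfolding inner_diff_left inner_diff_right n by (simp add: inner_commute)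
  have "(sgn w - sgn v) \<bullet> sgn w > 0" "(sgn w - sgn v) \<bullet> sgn v < 0"
    using n s by (simp_all add: inner_diff_left inner_commute[of "sgn w" "sgn v"])
  then show "(sgn w - sgn v) \<bullet> w > 0" "(sgn w - sgn v) \<bullet> v < 0"
    using assms by (simp_all add: sgn_div_norm zero_less_mult_iff mult_less_0_iff)
qed

section \<open>Functions of one real variable\<close>

text \<open>Second derivative test with differentiability of \<open>f'\<close> at the single point
  \<open>a\<close>: \<open>f'\<close> changes sign there, and the mean value theorem transfers this
  to \<open>f\<close>.\<close>

lemma strict_local_min:
  fixes f f' :: "real \<Rightarrow> real"
  assumes f: "\<And>t. (f has_real_derivative f' t) (at t)"
    and "f' a = 0" "(f' has_real_derivative l) (at a)" "l > 0"
  obtains d where "d > 0" "\<And>t. t \<noteq> a \<Longrightarrow> \<bar>t - a\<bar> \<le> d \<Longrightarrow> f a < f t"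
proof -
  obtain d1 where d1: "d1 > 0" "\<And>h. 0 < h \<Longrightarrow> h < d1 \<Longrightarrow> f' a < f' (a + h)"
    using DERIV_pos_inc_right[OF assms(3,4)] by blast
  obtain d2 where d2: "d2 > 0" "\<And>h. 0 < h \<Longrightarrow> h < d2 \<Longrightarrow> f' (a - h) < f' a"
    using DERIV_pos_inc_left[OF assms(3,4)] by blast
  define d where "d = min d1 d2 / 2"
  have "f a < f t" if t: "t \<noteq> a" "\<bar>t - a\<bar> \<le> d" for t
  proof (cases "t > a")
    case True
    obtain z where z: "a < z" "z < t" "f t - f a = (t - a) * f' z"
      using MVT2[OF True] f by blast
    have "f' z > 0" using d1(2)[of "z - a"] z t d1 d2 assms(2) by (auto simp: d_def)
    then show ?thesis using z(3) True by (metis diff_gt_0_iff_gt mult_pos_pos)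
  next
    case False
    then have lt: "t < a" using t by simp
    obtain z where z: "t < z" "z < a" "f a - f t = (a - t) * f' z"
      using MVT2[OF lt] f by blast
    have "f' z < 0" using d2(2)[of "a - z"] z t d1 d2 assms(2) by (auto simp: d_def)
    then have "f a - f t < 0" using z(3) lt by (simp add: mult_pos_neg)
    then show ?thesis by simp
  qed
  moreover have "d > 0" using d1 d2 by (simp add: d_def)
  ultimately show ?thesis using that by blast
qed

text \<open>Difference quotients along zeros tending to \<open>a\<close> vanish. Accumulating feet
  of normals, contact points of a supporting line and zeros of chart coordinates along the evolute
  are all treated this way.\<close>

lemma islimpt_zeros_imp_deriv_0:
  fixes G :: "real \<Rightarrow> real"
  assumes G: "(G has_real_derivative l) (at a)" and a: "a islimpt {t. G t = 0}"
  shows "G a = 0" "l = 0"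
proof -
  obtain s where s: "\<And>n::nat. s n \<in> {t. G t = 0} - {a}" "s \<longlonglongrightarrow> a"
    using a unfolding islimpt_sequential by blast
  have "isCont G a" using G by (rule DERIV_isCont)
  then have "(\<lambda>n. G (s n)) \<longlonglongrightarrow> G a" using s(2) by (rule isCont_tendsto_compose)
  moreover have "(\<lambda>n. G (s n)) = (\<lambda>n. 0)" using s(1) by auto
  ultimately show Ga: "G a = 0" using LIMSEQ_unique tendsto_const by metis
  have "((\<lambda>t. (G t - G a) / (t - a)) \<longlongrightarrow> l) (at a)"
    using G by (simp add: has_field_derivative_iff)
  moreover have "filterlim s (at a) sequentially"
    using s by (simp add: filterlim_at)
  ultimately have "(\<lambda>n. (G (s n) - G a) / (s n - a)) \<longlonglongrightarrow> l"
    by (rule filterlim_compose)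
  moreover have "(\<lambda>n. (G (s n) - G a) / (s n - a)) = (\<lambda>n. 0)" using s(1) Ga by auto
  ultimately show "l = 0" using LIMSEQ_unique tendsto_const by metis
qed

lemma IVT_strict:
  fixes f :: "real \<Rightarrow> real"
  assumes "a < b" "continuous_on UNIV f" "f a * f b < 0"
  obtains z where "a < z" "z < b" "f z = 0"
proof -
  have evolute: "continuous_on {a..b} f" using assms(2) continuous_on_subset by blast
  have "\<exists>z. a \<le> z \<and> z \<le> b \<and> f z = 0"
    using IVT'[of f a 0 b] IVT2'[of f b 0 a] evolute assms(1,3)
    by (cases "f a < 0") (auto simp: mult_less_0_iff)
  then obtain z where "a \<le> z" "z \<le> b" "f z = 0" by blast
  moreover have "z \<noteq> a" "z \<noteq> b" using assms(3) calculation(3) by auto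
  ultimately show ?thesis using that[of z] by simp
qed

text \<open>A set with empty interior lies in a hyperplane, whose normal supports it trivially;
  otherwise interior and relative interior agree.\<close>

lemma supporting_hyperplane_frontier:
  fixes S :: "'a::euclidean_space set"
  assumes "convex S" "x \<in> S" "x \<in> frontier S"
  obtains w where "w \<noteq> 0" "\<And>y. y \<in> S \<Longrightarrow> w \<bullet> x \<le> w \<bullet> y"
proof (cases "interior S = {}")
  case True
  then obtain w b where "w \<noteq> 0" "S \<subseteq> {y. w \<bullet> y = b}"
    using empty_interior_subset_hyperplane assms(1) by blast
  then have "w \<bullet> x \<le> w \<bullet> y" if "y \<in> S" for y using assms(2) that by (auto simp: subset_iff)
  then show ?thesis using that \<open>w \<noteq> 0\<close> by blast
next
  case False
  then have "rel_interior S = interior S" by (rule rel_interior_nonempty_interior)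
  then have "x \<notin> rel_interior S" using assms(3) by (simp add: frontier_def)
  then show ?thesis using supporting_hyperplane_rel_boundary[OF assms(1,2)] that by metis
qed

lemma has_vector_derivative_periodic:
  assumes f: "\<And>t. (f has_vector_derivative f' t) (at t)" and p: "\<And>t. f (t + p) = f t"
  shows "f' (t + p) = f' t"
proof -
  have "((\<lambda>s. s + p) has_vector_derivative 1) (at t)"
    using has_vector_derivative_add[OF has_vector_derivative_id has_vector_derivative_const] by simp
  from vector_diff_chain_at[OF this f]
  have "(f has_vector_derivative f' (t + p)) (at t)"
    by (simp add: o_def p)
  then show ?thesis by (rule vector_derivative_unique_at[OF _ f])
qed

lemma smooth_on_differentiable:
  assumes "smooth_on U f" "open U" "x \<in> U"
  shows "f differentiable at x" "dir_deriv v f differentiable at x"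
proof -
  have "foldr dir_deriv [] f differentiable_on U" "foldr dir_deriv [v] f differentiable_on U"
    using assms(1) unfolding smooth_on_def by blast+
  then show "f differentiable at x" "dir_deriv v f differentiable at x"
    using assms(2,3) by (simp_all add: differentiable_on_eq_differentiable_at)
qed

lemma smooth_on_deriv:
  fixes f :: "real \<Rightarrow> 'a::euclidean_space"
  assumes "smooth_on UNIV f"
  shows "(f has_vector_derivative dir_deriv 1 f t) (at t)" "smooth_on UNIV (dir_deriv 1 f)"
proof -
  have "f differentiable at t"
    using smooth_on_differentiable(1)[OF assms] by simp
  then have D: "(f has_derivative frechet_derivative f (at t)) (at t)" by (simp add: frechet_derivative_works)
  have "frechet_derivative f (at t) h = h *\<^sub>R frechet_derivative f (at t) 1" for h
    using linear_scale[OF has_derivative_linear[OF D], of h 1] by simp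
  then have "frechet_derivative f (at t) = (\<lambda>h. h *\<^sub>R frechet_derivative f (at t) 1)" by (rule ext)
  then show "(f has_vector_derivative dir_deriv 1 f t) (at t)"
    unfolding has_vector_derivative_def dir_deriv_def by (rule has_derivative_eq_rhs[OF D])
  show "smooth_on UNIV (dir_deriv 1 f)" unfolding smooth_on_def
  proof
    fix vs
    \<comment> \<open>\<open>foldr\<close> applies the last entry first, so the appended 1
      differentiates \<open>f\<close> before \<open>vs\<close> acts.\<close>
    have "foldr dir_deriv (vs @ [1]) f differentiable_on UNIV" using assms unfolding smooth_on_def by blast
    then show "foldr dir_deriv vs (dir_deriv 1 f) differentiable_on UNIV" by simp
  qed
qed

section \<open>Ovals\<close>

text \<open>Three derivatives are fixed as functions because \<open>normal_fn\<close> already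
  contains \<open>d1\<close> and is differentiated twice. \<open>nonflat\<close> concerns the
  numerator of the curvature, without the division by the cubed speed.\<close>

locale oval =
  fixes \<gamma> d1 d2 d3 :: "real \<Rightarrow> real^2" and \<tau> :: real
  assumes d1: "(\<gamma> has_vector_derivative d1 t) (at t)"
    and d2: "(d1 has_vector_derivative d2 t) (at t)"
    and d3: "(d2 has_vector_derivative d3 t) (at t)"
    and \<tau>_pos: "\<tau> > 0"
    and \<gamma>_eq_iff: "\<gamma> s = \<gamma> t \<longleftrightarrow> (\<exists>k::int. t - s = of_int k * \<tau>)"
    and convex: "convex_curve \<gamma>"
    and nonflat: "rot90 (d1 t) \<bullet> d2 t \<noteq> 0"
begin

lemma d1_nz: "d1 t \<noteq> 0"
  using nonflat[of t] by auto

lemma \<gamma>_period: "\<gamma> (t + of_int k * \<tau>) = \<gamma> t"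
proof -
  have "\<gamma> t = \<gamma> (t + of_int k * \<tau>)" unfolding \<gamma>_eq_iff by auto
  then show ?thesis by simp
qed

lemma d1_period: "d1 (t + of_int k * \<tau>) = d1 t"
  by (rule has_vector_derivative_periodic[OF d1 \<gamma>_period])

lemma \<gamma>_inj: assumes "\<gamma> s = \<gamma> t" "\<bar>t - s\<bar> < \<tau>" shows "s = t"
proof -
  obtain k :: int where k: "t - s = of_int k * \<tau>" using assms(1) \<gamma>_eq_iff by blast
  then have "\<bar>of_int k\<bar> * \<tau> < 1 * \<tau>" using assms(2) \<tau>_pos by (simp add: abs_mult)
  then have "\<bar>of_int k :: real\<bar> < 1" using \<tau>_pos mult_less_cancel_right_pos by blast
  then have "k = 0" by linarith
  then show ?thesis using k by simp
qed

lemma shift_into_period: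
  obtains k :: int where "a \<le> t + of_int k * \<tau>" "t + of_int k * \<tau> < a + \<tau>"
proof -
  define k where "k = \<lfloor>(t - a) / \<tau>\<rfloor>"
  have "of_int k \<le> (t - a) / \<tau>" "(t - a) / \<tau> < of_int k + 1" unfolding k_def by linarith+
  then have "of_int k * \<tau> \<le> t - a" "t - a < (of_int k + 1) * \<tau>"
    using \<tau>_pos by (simp_all add: pos_le_divide_eq pos_divide_less_eq)
  then show ?thesis using that[of "-k"] by (simp add: algebra_simps)
qed

lemma continuous_\<gamma>: "continuous_on UNIV \<gamma>" and continuous_d1: "continuous_on UNIV d1"
  and continuous_d2: "continuous_on UNIV d2"
  by (auto intro!: continuous_at_imp_continuous_on has_vector_derivative_continuous d1 d2 d3)

lemma range_\<gamma>: "range \<gamma> = \<gamma> ` {0..\<tau>}"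
proof -
  have "\<gamma> t \<in> \<gamma> ` {0..\<tau>}" for t
  proof -
    obtain k :: int where "0 \<le> t + of_int k * \<tau>" "t + of_int k * \<tau> < 0 + \<tau>"
      by (rule shift_into_period)
    then show ?thesis by (intro image_eqI[of _ _ "t + of_int k * \<tau>"]) (simp_all add: \<gamma>_period)
  qed
  then show ?thesis by auto
qed

lemma compact_range: "compact (range \<gamma>)"
  unfolding range_\<gamma>
  by (intro compact_continuous_image continuous_on_subset[OF continuous_\<gamma>]) auto

text \<open>For \<open>s = 1\<close> the zeros of \<open>normal_fn u s\<close> are the feet of the normals through \<open>u\<close>. The homogeneous
  coordinate \<open>s\<close> admits points at infinity (\<open>s = 0\<close>), which serve to bound the set of points with
  four normals.\<close>

definition normal_fn :: "real^2 \<Rightarrow> real \<Rightarrow> real \<Rightarrow> real" where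
  "normal_fn u s t = (u - s *\<^sub>R \<gamma> t) \<bullet> d1 t"

definition normal_fn' :: "real^2 \<Rightarrow> real \<Rightarrow> real \<Rightarrow> real" where
  "normal_fn' u s t = (u - s *\<^sub>R \<gamma> t) \<bullet> d2 t - s * (d1 t \<bullet> d1 t)"

definition normal_fn'' :: "real^2 \<Rightarrow> real \<Rightarrow> real \<Rightarrow> real" where
  "normal_fn'' u s t = (u - s *\<^sub>R \<gamma> t) \<bullet> d3 t - 3 * s * (d1 t \<bullet> d2 t)"

lemma position_deriv: "((\<lambda>t. u - s *\<^sub>R \<gamma> t) has_vector_derivative - (s *\<^sub>R d1 t)) (at t)"
  using has_vector_derivative_diff[OF has_vector_derivative_const
      bounded_linear.has_vector_derivative[OF bounded_linear_scaleR_right d1]]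
  by simp

lemmas inner_deriv = bounded_bilinear.has_vector_derivative[OF bounded_bilinear_inner]

lemma normal_fn_deriv: "(normal_fn u s has_real_derivative normal_fn' u s t) (at t)"
  using inner_deriv[OF position_deriv d2, of u s t]
  unfolding normal_fn_def[abs_def] normal_fn'_def has_real_derivative_iff_has_vector_derivative by simp

lemma normal_fn'_deriv: "(normal_fn' u s has_real_derivative normal_fn'' u s t) (at t)"
proof -
  have "((\<lambda>t. (u - s *\<^sub>R \<gamma> t) \<bullet> d2 t - s * (d1 t \<bullet> d1 t)) has_vector_derivative
      (u - s *\<^sub>R \<gamma> t) \<bullet> d3 t + (- (s *\<^sub>R d1 t)) \<bullet> d2 t - s * (d1 t \<bullet> d2 t + d2 t \<bullet> d1 t)) (at t)"
    by (intro has_vector_derivative_diff inner_deriv position_deriv d2 d3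
        has_vector_derivative_mult_right)
  moreover have "(u - s *\<^sub>R \<gamma> t) \<bullet> d3 t + (- (s *\<^sub>R d1 t)) \<bullet> d2 t - s * (d1 t \<bullet> d2 t + d2 t \<bullet> d1 t)
      = normal_fn'' u s t"
    unfolding normal_fn''_def by (simp only: inner_minus_left inner_scaleR_left inner_commute[of "d2 t" "d1 t"])
      (simp add: algebra_simps)
  ultimately show ?thesis
    unfolding normal_fn'_def[abs_def] has_real_derivative_iff_has_vector_derivative by simp
qed

lemma continuous_fn: "continuous_on UNIV (normal_fn u s)"
  by (auto intro!: continuous_at_imp_continuous_on DERIV_isCont normal_fn_deriv)

lemma normal_fn_period: "normal_fn u s (t + of_int k * \<tau>) = normal_fn u s t"
  by (simp add: normal_fn_def \<gamma>_period d1_period)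

lemma normal_fn_period1: "normal_fn u s (t + \<tau>) = normal_fn u s t" "normal_fn u s (t - \<tau>) = normal_fn u s t"
  using normal_fn_period[of u s t 1] normal_fn_period[of u s t "-1"] by simp_all

section \<open>Convexity: tangents as supporting lines, and distinct tangent directions\<close>

lemma curvature_sign: "(rot90 (d1 a) \<bullet> d2 a) * (rot90 (d1 b) \<bullet> d2 b) > 0"
proof -
  have *: "(rot90 (d1 a) \<bullet> d2 a) * (rot90 (d1 b) \<bullet> d2 b) > 0" if ab: "a < b" for a b
  proof (rule ccontr)
    assume "\<not> ?thesis"
    then have "(rot90 (d1 a) \<bullet> d2 a) * (rot90 (d1 b) \<bullet> d2 b) < 0"
      using nonflat[of a] nonflat[of b] by (simp add: not_less order_less_le)
    moreover have "continuous_on UNIV (\<lambda>t. rot90 (d1 t) \<bullet> d2 t)"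
      by (intro continuous_intros continuous_d2 continuous_d1
          bounded_linear.continuous_on[OF bounded_linear_rot90])
    ultimately obtain z where "rot90 (d1 z) \<bullet> d2 z = 0"
      using IVT_strict[OF ab, of "\<lambda>t. rot90 (d1 t) \<bullet> d2 t"] by blast
    then show False using nonflat by blast
  qed
  show ?thesis
    using *[of a b] *[of b a] nonflat[of a] by (cases a b rule: linorder_cases) (auto simp: mult.commute zero_less_mult_iff)
qed

lemma inner_\<gamma>_deriv: "((\<lambda>t. w \<bullet> \<gamma> t) has_real_derivative w \<bullet> d1 t) (at t)"
  and inner_d1_deriv: "((\<lambda>t. w \<bullet> d1 t) has_real_derivative w \<bullet> d2 t) (at t)"
  using inner_deriv[OF has_vector_derivative_const d1, of w t]
    inner_deriv[OF has_vector_derivative_const d2, of w t]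
  by (simp_all add: has_real_derivative_iff_has_vector_derivative)

lemma inner_\<gamma>_min:
  assumes "\<And>t. w \<bullet> \<gamma> a \<le> w \<bullet> \<gamma> t"
  shows "w \<bullet> d1 a = 0"
  using DERIV_local_min[OF inner_\<gamma>_deriv[of w a], of 1] assms by simp

text \<open>A functional supporting the hull at \<open>\<gamma> a\<close> is minimal there along the
  curve, hence equals \<open>q\<close> times \<open>rot90 (d1 a)\<close>. The second derivative test
  gives \<open>q\<close> the sign of the curvature, so the curvature numerator can replace
  \<open>q\<close>.\<close>

lemma tangent_line_supports:
  "(rot90 (d1 a) \<bullet> d2 a) * (rot90 (d1 a) \<bullet> \<gamma> a) \<le> (rot90 (d1 a) \<bullet> d2 a) * (rot90 (d1 a) \<bullet> \<gamma> t)"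
proof -
  have "\<gamma> a \<in> frontier (convex hull (range \<gamma>))"
    using convex by (metis convex_curve_def rangeI)
  then obtain w where w: "w \<noteq> 0" "\<And>y. y \<in> convex hull (range \<gamma>) \<Longrightarrow> w \<bullet> \<gamma> a \<le> w \<bullet> y"
    using supporting_hyperplane_frontier[OF convex_convex_hull] hull_inc[of "\<gamma> a" "range \<gamma>"] by blast
  have min: "w \<bullet> \<gamma> a \<le> w \<bullet> \<gamma> t" for t
    using w(2) by (simp add: hull_inc)
  then have "w \<bullet> d1 a = 0" by (rule inner_\<gamma>_min)
  then obtain q where q: "w = q *\<^sub>R rot90 (d1 a)"
    using orthogonal_imp_multiple_rot90 d1_nz by blast
  have "q * (rot90 (d1 a) \<bullet> d2 a) > 0"
  proof (rule ccontr)
    assume "\<not> ?thesis"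
    moreover have "q \<noteq> 0" using q w by auto
    ultimately have neg: "- (w \<bullet> d2 a) > 0"
      using nonflat[of a] by (simp add: q not_less order_less_le)
    have d: "\<And>t. ((\<lambda>t. - (w \<bullet> \<gamma> t)) has_real_derivative - (w \<bullet> d1 t)) (at t)"
      "((\<lambda>t. - (w \<bullet> d1 t)) has_real_derivative - (w \<bullet> d2 a)) (at a)"
      using DERIV_minus[OF inner_\<gamma>_deriv] DERIV_minus[OF inner_d1_deriv] by auto
    have z: "- (w \<bullet> d1 a) = 0" using \<open>w \<bullet> d1 a = 0\<close> by simp
    \<comment> \<open>With the wrong sign of \<open>q\<close>, the minimum of the functional at
      \<open>a\<close> would be a strict local maximum.\<close>
    obtain d where d: "d > 0" "\<And>t. t \<noteq> a \<Longrightarrow> \<bar>t - a\<bar> \<le> d \<Longrightarrow> - (w \<bullet> \<gamma> a) < - (w \<bullet> \<gamma> t)"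
      using strict_local_min[OF d(1) z d(2) neg] by metis
    show False using d(2)[of "a + d"] d(1) min[of "a + d"] by simp
  qed
  then have "(rot90 (d1 a) \<bullet> d2 a > 0 \<and> q > 0) \<or> (rot90 (d1 a) \<bullet> d2 a < 0 \<and> q < 0)"
    by (auto simp: zero_less_mult_iff)
  then show ?thesis
    using min[of t] by (auto simp: q mult_le_cancel_left)
qed

text \<open>Points with equal unit tangents share a supporting line. The segment joining them lies
  on that line and in the frontier of the hull, hence in the curve; but the curve meets the line in
  finitely many points, so the segment is a single point.\<close>

lemma sgn_tangent_inj:
  assumes "sgn (d1 a) = sgn (d1 b)"
  shows "\<gamma> a = \<gamma> b"
proof -
  define k where "k t = rot90 (d1 t) \<bullet> d2 t" for t
  define n where "n = k a *\<^sub>R rot90 (d1 a)"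
  have n0: "n \<noteq> 0" using nonflat d1_nz by (simp add: n_def k_def)
  have min_a: "n \<bullet> \<gamma> a \<le> n \<bullet> \<gamma> t" for t
    using tangent_line_supports[of a t] by (simp add: n_def k_def)
  \<comment> \<open>Equal unit tangents and equal curvature signs make \<open>n\<close> a positive
    multiple of the corresponding normal at \<open>b\<close>.\<close>
  have min_b: "n \<bullet> \<gamma> b \<le> n \<bullet> \<gamma> t" for t
  proof -
    have "d1 a = norm (d1 a) *\<^sub>R sgn (d1 b)"
      using assms d1_nz by (metis norm_sgn sgn_div_norm divideR_right norm_eq_zero)
    then have "d1 a = (norm (d1 a) / norm (d1 b)) *\<^sub>R d1 b"
      by (simp add: sgn_div_norm divide_inverse)
    then obtain l where l: "l > 0" "d1 a = l *\<^sub>R d1 b"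
      using d1_nz by (metis divide_pos_pos zero_less_norm_iff)
    have "(k a > 0 \<and> k b > 0) \<or> (k a < 0 \<and> k b < 0)"
      using curvature_sign[of a b] unfolding k_def by (auto simp: zero_less_mult_iff)
    moreover have "k b * (rot90 (d1 b) \<bullet> \<gamma> b) \<le> k b * (rot90 (d1 b) \<bullet> \<gamma> t)"
      using tangent_line_supports[of b t] by (simp add: k_def)
    ultimately show ?thesis using l
      by (auto simp: n_def l(2) rot90_scaleR mult_le_cancel_left mult_less_0_iff zero_less_mult_iff)
  qed
  define Z where "Z = {t \<in> {0..\<tau>}. n \<bullet> \<gamma> t = n \<bullet> \<gamma> a}"
  \<comment> \<open>An accumulation point \<open>z\<close> of contacts would make \<open>n\<close>
    orthogonal to the independent vectors \<open>d1 z\<close> and \<open>d2 z\<close>.\<close>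
  have "finite Z"
  proof (rule ccontr)
    assume "infinite Z"
    then obtain z where "z islimpt Z"
      using compact_eq_Bolzano_Weierstrass[of "{0..\<tau>}"] by (auto simp: Z_def)
    moreover have "Z \<subseteq> {t. n \<bullet> d1 t = 0}"
      using min_a inner_\<gamma>_min[of n] by (auto simp: Z_def)
    ultimately have "z islimpt {t. n \<bullet> d1 t = 0}" by (rule islimpt_subset)
    then have "n \<bullet> d1 z = 0" "n \<bullet> d2 z = 0"
      using islimpt_zeros_imp_deriv_0[OF inner_d1_deriv] by blast+
    then show False using orthogonal_two_imp_0 nonflat n0 by blast
  qed
  have "closed_segment (\<gamma> a) (\<gamma> b) \<subseteq> \<gamma> ` Z"
  proof
    fix y assume y: "y \<in> closed_segment (\<gamma> a) (\<gamma> b)"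
    have "n \<bullet> \<gamma> a = n \<bullet> \<gamma> b" using min_a min_b order_antisym by blast
    moreover obtain r where "y = (1 - r) *\<^sub>R \<gamma> a + r *\<^sub>R \<gamma> b"
      using y by (auto simp: in_segment)
    then have "n \<bullet> y = (1 - r) * (n \<bullet> \<gamma> a) + r * (n \<bullet> \<gamma> b)" by (simp add: inner_add_right)
    ultimately have ny: "n \<bullet> y = n \<bullet> \<gamma> a" by (simp add: algebra_simps)
    have "y \<in> convex hull (range \<gamma>)"
      using y closed_segment_subset_convex_hull[of "\<gamma> a" "range \<gamma>" "\<gamma> b"] by (auto simp: hull_inc)
    moreover have "y \<notin> interior (convex hull (range \<gamma>))"
    proof
      assume "y \<in> interior (convex hull (range \<gamma>))"
      then obtain e where e: "e > 0" "cball y e \<subseteq> convex hull (range \<gamma>)"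
        using mem_interior_cball by blast
      \<comment> \<open>A step against the inner normal \<open>n\<close> leaves the supporting
        half-plane.\<close>
      have "y - e *\<^sub>R sgn n \<in> cball y e" using e n0 by (simp add: dist_norm norm_sgn)
      then have "y - e *\<^sub>R sgn n \<in> convex hull (range \<gamma>)" using e by blast
      moreover have "convex hull (range \<gamma>) \<subseteq> {y. n \<bullet> \<gamma> a \<le> n \<bullet> y}"
        by (rule hull_minimal) (auto simp: min_a convex_halfspace_ge)
      ultimately have "n \<bullet> \<gamma> a \<le> n \<bullet> y - e * (n \<bullet> sgn n)" by (auto simp: inner_diff_right)
      moreover have "n \<bullet> sgn n > 0" using n0 by (simp add: sgn_div_norm)
      ultimately show False using ny e mult_pos_pos[of e "n \<bullet> sgn n"] by linarith
    qed
    moreover have "closed (convex hull (range \<gamma>))"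
      using compact_range compact_convex_hull compact_imp_closed by blast
    ultimately have "y \<in> frontier (convex hull (range \<gamma>))" by (simp add: frontier_def)
    then have "y \<in> range \<gamma>" using convex unfolding convex_curve_def by (rule ssubst[where P = "\<lambda>A. y \<in> A", rotated])
    then show "y \<in> \<gamma> ` Z" using ny by (auto simp: range_\<gamma> Z_def)
  qed
  then show ?thesis using \<open>finite Z\<close> finite_subset finite_closed_segment by blast
qed

lemma sgn_tangent_neq:
  assumes "a < b" "b < a + \<tau>"
  shows "sgn (d1 a) \<noteq> sgn (d1 b)"
proof
  assume "sgn (d1 a) = sgn (d1 b)"
  then have "\<gamma> a = \<gamma> b" by (rule sgn_tangent_inj)
  then show False using \<gamma>_inj[of a b] assms by simp
qed

section \<open>The caustic as a curve\<close>

text \<open>The curvature center with the norms cancelled, so that its differentiability follows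
  from that of \<open>d1\<close> and \<open>d2\<close>.\<close>

definition evolute :: "real \<Rightarrow> real^2" where
  "evolute t = \<gamma> t + (d1 t \<bullet> d1 t / (rot90 (d1 t) \<bullet> d2 t)) *\<^sub>R rot90 (d1 t)"

definition evolute' :: "real \<Rightarrow> real^2" where
  "evolute' t = vector_derivative evolute (at t)"

lemma vector_derivative_\<gamma>: "vector_derivative \<gamma> (at t) = d1 t"
  using d1 vector_derivative_at by blast

lemma caustic_eq: "caustic \<gamma> = range evolute"
proof -
  have d: "vector_derivative d1 (at t) = d2 t" for t
    using d2 vector_derivative_at by blast
  have "curvature_center \<gamma> t = evolute t" for t
  proof -
    have "norm (d1 t) ^ 3 / norm (d1 t) = d1 t \<bullet> d1 t"
      using d1_nz[of t] by (simp add: dot_square_norm power2_eq_square power3_eq_cube)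
    then show ?thesis
      unfolding curvature_center_def curvature_def evolute_def Let_def vector_derivative_\<gamma> d
      by (simp add: field_simps)
  qed
  then show ?thesis by (simp add: caustic_def)
qed

text \<open>The first equation puts \<open>Q\<close> on the normal at \<open>t\<close>, that is, at
  \<open>\<gamma> t\<close> plus a multiple \<open>q\<close> of \<open>rot90 (d1 t)\<close>; the
  second equation then determines \<open>q\<close>.\<close>

lemma double_zero_iff: "normal_fn Q 1 t = 0 \<and> normal_fn' Q 1 t = 0 \<longleftrightarrow> Q = evolute t"
proof
  assume *: "normal_fn Q 1 t = 0 \<and> normal_fn' Q 1 t = 0"
  then obtain q where q: "Q - \<gamma> t = q *\<^sub>R rot90 (d1 t)"
    using orthogonal_imp_multiple_rot90[of "Q - \<gamma> t" "d1 t"] d1_nz by (auto simp: normal_fn_def)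
  then have "q * (rot90 (d1 t) \<bullet> d2 t) = d1 t \<bullet> d1 t" using * by (simp add: normal_fn'_def)
  then have "q = d1 t \<bullet> d1 t / (rot90 (d1 t) \<bullet> d2 t)" using nonflat by (simp add: eq_divide_eq)
  then show "Q = evolute t" using q by (simp add: evolute_def algebra_simps)
next
  assume "Q = evolute t"
  then show "normal_fn Q 1 t = 0 \<and> normal_fn' Q 1 t = 0"
    using nonflat[of t] by (simp add: normal_fn_def normal_fn'_def evolute_def)
qed

lemma caustic_iff: "Q \<in> caustic \<gamma> \<longleftrightarrow> (\<exists>t. normal_fn Q 1 t = 0 \<and> normal_fn' Q 1 t = 0)"
  unfolding double_zero_iff by (auto simp: caustic_eq)

lemma evolute_deriv: "(evolute has_vector_derivative evolute' t) (at t)"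
proof -
  have r: "((\<lambda>t. rot90 (d1 t)) has_vector_derivative rot90 (d2 t)) (at t)"
    by (rule bounded_linear.has_vector_derivative[OF bounded_linear_rot90 d2])
  have k: "((\<lambda>t. rot90 (d1 t) \<bullet> d2 t) has_real_derivative
      rot90 (d1 t) \<bullet> d3 t + rot90 (d2 t) \<bullet> d2 t) (at t)"
    using inner_deriv[OF r d3] by (simp add: has_real_derivative_iff_has_vector_derivative)
  have n: "((\<lambda>t. d1 t \<bullet> d1 t) has_real_derivative d1 t \<bullet> d2 t + d2 t \<bullet> d1 t) (at t)"
    using inner_deriv[OF d2 d2] by (simp add: has_real_derivative_iff_has_vector_derivative)
  have "\<exists>v. (evolute has_vector_derivative v) (at t)"
    unfolding evolute_def[abs_def]
    by (rule exI, rule has_vector_derivative_add[OF d1 has_vector_derivative_scaleR[OF DERIV_divide[OF n k nonflat] r]])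
  then show ?thesis unfolding evolute'_def
    using vector_derivative_works differentiableI_vector by blast
qed

text \<open>With \<open>evolute t\<close> as the point, \<open>normal_fn\<close> and
  \<open>normal_fn'\<close> vanish at \<open>t\<close> for every \<open>t\<close>. Differentiating
  these two identities in \<open>t\<close> gives the claims without an explicit formula for
  \<open>evolute'\<close>.\<close>

lemma evolute'_orthogonal: "evolute' t \<bullet> d1 t = 0"
  and normal_fn''_evolute: "normal_fn'' (evolute t) 1 t = - (evolute' t \<bullet> d2 t)"
proof -
  have cg: "((\<lambda>t. evolute t - \<gamma> t) has_vector_derivative evolute' t - d1 t) (at t)"
    by (rule has_vector_derivative_diff[OF evolute_deriv d1])
  have z: "(evolute s - \<gamma> s) \<bullet> d1 s = 0" "(evolute s - \<gamma> s) \<bullet> d2 s - d1 s \<bullet> d1 s = 0" for s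
    using double_zero_iff[of "evolute s" s] by (simp_all add: normal_fn_def normal_fn'_def)
  have "((\<lambda>s. (evolute s - \<gamma> s) \<bullet> d1 s) has_vector_derivative
      (evolute t - \<gamma> t) \<bullet> d2 t + (evolute' t - d1 t) \<bullet> d1 t) (at t)"
    by (rule inner_deriv[OF cg d2])
  then have "((\<lambda>s. 0::real) has_vector_derivative (evolute t - \<gamma> t) \<bullet> d2 t + (evolute' t - d1 t) \<bullet> d1 t) (at t)"
    by (simp only: z)
  then have "(evolute t - \<gamma> t) \<bullet> d2 t + (evolute' t - d1 t) \<bullet> d1 t = 0"
    by (rule vector_derivative_unique_at[OF _ has_vector_derivative_const])
  then show "evolute' t \<bullet> d1 t = 0" using z(2)[of t] by (simp add: inner_diff_left)
  have "((\<lambda>s. (evolute s - \<gamma> s) \<bullet> d2 s - d1 s \<bullet> d1 s) has_vector_derivative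
      (evolute t - \<gamma> t) \<bullet> d3 t + (evolute' t - d1 t) \<bullet> d2 t - (d1 t \<bullet> d2 t + d2 t \<bullet> d1 t)) (at t)"
    by (intro has_vector_derivative_diff inner_deriv cg d2 d3)
  then have "((\<lambda>s. 0::real) has_vector_derivative
      (evolute t - \<gamma> t) \<bullet> d3 t + (evolute' t - d1 t) \<bullet> d2 t - (d1 t \<bullet> d2 t + d2 t \<bullet> d1 t)) (at t)"
    by (simp only: z)
  then have "(evolute t - \<gamma> t) \<bullet> d3 t + (evolute' t - d1 t) \<bullet> d2 t - (d1 t \<bullet> d2 t + d2 t \<bullet> d1 t) = 0"
    by (rule vector_derivative_unique_at[OF _ has_vector_derivative_const])
  then show "normal_fn'' (evolute t) 1 t = - (evolute' t \<bullet> d2 t)"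
    by (simp add: normal_fn''_def inner_diff_left inner_diff_right inner_commute)
qed

lemma continuous_evolute: "continuous_on UNIV evolute"
  by (auto intro!: continuous_at_imp_continuous_on has_vector_derivative_continuous evolute_deriv)

text \<open>A differentiable image of the line in the plane is a null set and so contains no
  nonempty open set.\<close>

lemma interior_caustic: "interior (caustic \<gamma>) = {}"
proof -
  have "evolute differentiable_on UNIV"
    using evolute_deriv by (auto simp: differentiable_on_def intro: differentiableI_vector)
  then have "negligible (range evolute)" by (rule negligible_differentiable_image_lowdim[rotated]) simp
  then have "negligible (interior (range evolute))" using interior_subset negligible_subset by blast
  then show ?thesis using open_not_negligible open_interior by (metis caustic_eq)
qed

section \<open>Counting normals\<close>

text \<open>The parameters span less than one period, so the feet are distinct. Where the period
  starts is left open, so the feet may be rotated cyclically.\<close>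

definition three_normals :: "real^2 \<Rightarrow> bool" where
  "three_normals Q \<longleftrightarrow> (\<exists>t1 t2 t3. t1 < t2 \<and> t2 < t3 \<and> t3 < t1 + \<tau> \<and>
     normal_fn Q 1 t1 = 0 \<and> normal_fn Q 1 t2 = 0 \<and> normal_fn Q 1 t3 = 0)"

definition four_normals :: "real^2 \<Rightarrow> real \<Rightarrow> bool" where
  "four_normals u s \<longleftrightarrow> (\<exists>t1 t2 t3 t4. t1 < t2 \<and> t2 < t3 \<and> t3 < t4 \<and> t4 < t1 + \<tau> \<and>
     normal_fn u s t1 = 0 \<and> normal_fn u s t2 = 0 \<and> normal_fn u s t3 = 0 \<and> normal_fn u s t4 = 0)"

lemma four_imp_three:
  assumes "four_normals Q 1"
  shows "three_normals Q"
proof -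
  obtain t1 t2 t3 t4 where "t1 < t2" "t2 < t3" "t3 < t4" "t4 < t1 + \<tau>"
    "normal_fn Q 1 t1 = 0" "normal_fn Q 1 t2 = 0" "normal_fn Q 1 t3 = 0"
    using assms unfolding four_normals_def by blast
  moreover from this have "t3 < t1 + \<tau>" by linarith
  ultimately show ?thesis unfolding three_normals_def by blast
qed

text \<open>\<open>normal_line\<close> refers to some parameter of the point; by periodicity of
  \<open>d1\<close> every parameter of it gives the same line.\<close>

lemma normal_line_iff: "Q \<in> normal_line \<gamma> (\<gamma> t) \<longleftrightarrow> normal_fn Q 1 t = 0"
proof -
  have *: "(Q - \<gamma> t) \<bullet> d1 s = normal_fn Q 1 t" if st: "\<gamma> s = \<gamma> t" for s
  proof -
    obtain k :: int where "t - s = of_int k * \<tau>" using iffD1[OF \<gamma>_eq_iff st] by blast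
    then have "t = s + of_int k * \<tau>" by simp
    then have "d1 t = d1 s" by (simp only: d1_period)
    then show ?thesis by (simp add: normal_fn_def)
  qed
  show ?thesis
  proof
    assume "Q \<in> normal_line \<gamma> (\<gamma> t)"
    then obtain s where "\<gamma> s = \<gamma> t" "(Q - \<gamma> t) \<bullet> d1 s = 0"
      unfolding normal_line_def vector_derivative_\<gamma> by blast
    then show "normal_fn Q 1 t = 0" using *[of s] by simp
  next
    assume "normal_fn Q 1 t = 0"
    then have "(Q - \<gamma> t) \<bullet> d1 t = 0" using *[of t] by simp
    then show "Q \<in> normal_line \<gamma> (\<gamma> t)" unfolding normal_line_def vector_derivative_\<gamma> by blast
  qed
qed

lemma in_period:
  assumes "P \<in> range \<gamma>"
  obtains t where "0 \<le> t" "t < \<tau>" "P = \<gamma> t"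
proof -
  obtain s where s: "P = \<gamma> s" using assms by blast
  obtain k :: int where "0 \<le> s + of_int k * \<tau>" "s + of_int k * \<tau> < 0 + \<tau>"
    by (rule shift_into_period)
  then show ?thesis using that[of "s + of_int k * \<tau>"] s by (simp add: \<gamma>_period)
qed

lemma orthotricentersI:
  assumes "S \<subseteq> range \<gamma>" "card S = 3" "Q \<in> (\<Inter>P\<in>S. normal_line \<gamma> P)"
  shows "Q \<in> orthotricenters \<gamma>"
  unfolding orthotricenters_def orthotripod_def
  by (rule CollectI, rule exI[of _ S], intro conjI assms) (use assms(3) in blast)

lemma orthotricenters_iff: "Q \<in> orthotricenters \<gamma> \<longleftrightarrow> three_normals Q"
proof
  assume "Q \<in> orthotricenters \<gamma>"
  then obtain S where S: "S \<subseteq> range \<gamma>" "card S = 3" "\<And>P. P \<in> S \<Longrightarrow> Q \<in> normal_line \<gamma> P"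
    by (auto simp: orthotricenters_def orthotripod_def)
  obtain A B C where ABC: "S = {A, B, C}" "A \<noteq> B" "B \<noteq> C" "A \<noteq> C"
    using S(2) card_3_iff[of S] by auto
  have r: "A \<in> range \<gamma>" "B \<in> range \<gamma>" "C \<in> range \<gamma>" using S(1) ABC(1) by auto
  obtain a where a: "0 \<le> a" "a < \<tau>" "A = \<gamma> a" by (rule in_period[OF r(1)])
  obtain b where b: "0 \<le> b" "b < \<tau>" "B = \<gamma> b" by (rule in_period[OF r(2)])
  obtain d where d: "0 \<le> d" "d < \<tau>" "C = \<gamma> d" by (rule in_period[OF r(3)])
  have z: "normal_fn Q 1 a = 0" "normal_fn Q 1 b = 0" "normal_fn Q 1 d = 0"
    using S(3) ABC a b d normal_line_iff by auto
  have "a \<noteq> b" "b \<noteq> d" "a \<noteq> d" using ABC a b d by auto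
  then have "\<exists>x\<in>{a, b, d}. \<exists>y\<in>{a, b, d}. \<exists>z\<in>{a, b, d}. x < y \<and> y < z"
    by (auto simp: linorder_neq_iff)
  then obtain x y w where "x \<in> {a, b, d}" "y \<in> {a, b, d}" "w \<in> {a, b, d}" "x < y" "y < w"
    by blast
  moreover have "w < x + \<tau>" using calculation a b d by auto
  ultimately show "three_normals Q" unfolding three_normals_def using z by blast
next
  assume "three_normals Q"
  then obtain t1 t2 t3 where t: "t1 < t2" "t2 < t3" "t3 < t1 + \<tau>"
    "normal_fn Q 1 t1 = 0" "normal_fn Q 1 t2 = 0" "normal_fn Q 1 t3 = 0"
    unfolding three_normals_def by blast
  have "\<gamma> t1 \<noteq> \<gamma> t2" "\<gamma> t2 \<noteq> \<gamma> t3" "\<gamma> t1 \<noteq> \<gamma> t3"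
    using \<gamma>_inj[of t1 t2] \<gamma>_inj[of t2 t3] \<gamma>_inj[of t1 t3] t by auto
  then have "card {\<gamma> t1, \<gamma> t2, \<gamma> t3} = 3" by simp
  moreover have "Q \<in> (\<Inter>P\<in>{\<gamma> t1, \<gamma> t2, \<gamma> t3}. normal_line \<gamma> P)"
    using t by (simp add: normal_line_iff)
  ultimately show "Q \<in> orthotricenters \<gamma>"
    by (intro orthotricentersI[of "{\<gamma> t1, \<gamma> t2, \<gamma> t3}"]) simp_all
qed

lemma num_normals_ge_4_imp_three:
  assumes "num_normals \<gamma> Q \<ge> 4"
  shows "three_normals Q"
proof -
  have "3 \<le> card {P \<in> range \<gamma>. Q \<in> normal_line \<gamma> P}" using assms by (simp add: num_normals_def)
  then obtain S where S: "S \<subseteq> {P \<in> range \<gamma>. Q \<in> normal_line \<gamma> P}" "card S = 3"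
    by (rule obtain_subset_with_card_n)
  then have "S \<subseteq> range \<gamma>" "Q \<in> (\<Inter>P\<in>S. normal_line \<gamma> P)" by auto
  then have "Q \<in> orthotricenters \<gamma>"
    using S(2) orthotricentersI by blast
  then show ?thesis by (simp add: orthotricenters_iff)
qed

text \<open>Off the caustic all zeros are simple, hence isolated in a compact period. Finiteness
  keeps \<open>num_normals\<close> away from the value 0 that \<open>card\<close> takes on infinite
  sets.\<close>

lemma finite_zeros:
  assumes "Q \<notin> caustic \<gamma>"
  shows "finite {t \<in> {0..\<tau>}. normal_fn Q 1 t = 0}"
proof (rule ccontr)
  assume "infinite {t \<in> {0..\<tau>}. normal_fn Q 1 t = 0}"
  then obtain z where "z islimpt {t \<in> {0..\<tau>}. normal_fn Q 1 t = 0}"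
    using compact_eq_Bolzano_Weierstrass[of "{0..\<tau>}"] by auto
  then have "z islimpt {t. normal_fn Q 1 t = 0}" by (rule islimpt_subset) auto
  then have "normal_fn Q 1 z = 0" "normal_fn' Q 1 z = 0"
    by (rule islimpt_zeros_imp_deriv_0[OF normal_fn_deriv])+
  then show False using assms caustic_iff by blast
qed

lemma four_imp_num_normals_ge_4:
  assumes "four_normals Q 1" "Q \<notin> caustic \<gamma>"
  shows "num_normals \<gamma> Q \<ge> 4"
proof -
  obtain t1 t2 t3 t4 where t: "t1 < t2" "t2 < t3" "t3 < t4" "t4 < t1 + \<tau>"
    "normal_fn Q 1 t1 = 0" "normal_fn Q 1 t2 = 0" "normal_fn Q 1 t3 = 0" "normal_fn Q 1 t4 = 0"
    using assms(1) unfolding four_normals_def by blast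
  define N where "N = {P \<in> range \<gamma>. Q \<in> normal_line \<gamma> P}"
  have "N \<subseteq> \<gamma> ` {t \<in> {0..\<tau>}. normal_fn Q 1 t = 0}"
  proof
    fix P assume P: "P \<in> N"
    then have "P \<in> range \<gamma>" by (simp add: N_def)
    then obtain t where "0 \<le> t" "t < \<tau>" "P = \<gamma> t" by (rule in_period)
    then show "P \<in> \<gamma> ` {t \<in> {0..\<tau>}. normal_fn Q 1 t = 0}"
      using P by (auto simp: N_def normal_line_iff)
  qed
  then have fin: "finite N" using finite_zeros[OF assms(2)] finite_subset by blast
  have "\<gamma> t1 \<noteq> \<gamma> t2" "\<gamma> t1 \<noteq> \<gamma> t3" "\<gamma> t1 \<noteq> \<gamma> t4" "\<gamma> t2 \<noteq> \<gamma> t3" "\<gamma> t2 \<noteq> \<gamma> t4" "\<gamma> t3 \<noteq> \<gamma> t4"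
    using \<gamma>_inj[of t1 t2] \<gamma>_inj[of t1 t3] \<gamma>_inj[of t1 t4] \<gamma>_inj[of t2 t3] \<gamma>_inj[of t2 t4]
      \<gamma>_inj[of t3 t4] t by auto
  then have "card {\<gamma> t1, \<gamma> t2, \<gamma> t3, \<gamma> t4} = 4" by simp
  moreover have "{\<gamma> t1, \<gamma> t2, \<gamma> t3, \<gamma> t4} \<subseteq> N" using t by (auto simp: N_def normal_line_iff)
  ultimately show ?thesis unfolding num_normals_def N_def[symmetric]
    using card_mono[OF fin, of "{\<gamma> t1, \<gamma> t2, \<gamma> t3, \<gamma> t4}"] by linarith
qed

section \<open>From three normals to four by a small displacement\<close>

lemma normal_fn_sgn_imp_0:
  assumes "\<And>t. 0 \<le> r * normal_fn Q 1 t" "r \<noteq> 0"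
  shows "normal_fn Q 1 t = 0"
proof -
  \<comment> \<open>Up to the factor \<open>r\<close>, this is the squared distance to
    \<open>Q\<close>, with derivative \<open>-2 * normal_fn Q 1\<close>. A monotone periodic
    function is constant.\<close>
  define g where "g t = r * ((Q - \<gamma> t) \<bullet> (Q - \<gamma> t))" for t
  have "((\<lambda>t. Q - \<gamma> t) has_vector_derivative - d1 t) (at t)" for t
    using position_deriv[of Q 1 t] by simp
  from inner_deriv[OF this this]
  have "((\<lambda>t. (Q - \<gamma> t) \<bullet> (Q - \<gamma> t)) has_vector_derivative - 2 * normal_fn Q 1 t) (at t)" for t
    by (simp add: normal_fn_def inner_commute)
  then have g: "(g has_real_derivative r * (- 2 * normal_fn Q 1 t)) (at t)" for t
    unfolding g_def[abs_def] has_real_derivative_iff_has_vector_derivative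
    by (rule has_vector_derivative_mult_right)
  have le: "r * (- 2 * normal_fn Q 1 t) \<le> 0" for t
    using assms(1)[of t] by simp
  have mono: "g t \<le> g s" if "s \<le> t" for s t
    by (rule DERIV_nonpos_imp_nonincreasing[OF that]) (use g le in blast)
  have "g t \<le> g s" for s t
  proof -
    obtain k :: int where "s \<le> t + of_int k * \<tau>" "t + of_int k * \<tau> < s + \<tau>"
      by (rule shift_into_period)
    then show ?thesis using mono[of s "t + of_int k * \<tau>"] by (simp add: g_def \<gamma>_period)
  qed
  then have "g = (\<lambda>_. g 0)" by (intro ext order_antisym)
  then have "(g has_real_derivative 0) (at t)" by (rule ssubst) (rule DERIV_const)
  with g have "r * (- 2 * normal_fn Q 1 t) = 0" by (rule DERIV_unique)
  then show ?thesis using assms(2) by simp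
qed

lemma both_signs:
  assumes "normal_fn Q 1 t \<noteq> 0"
  obtains p q where "normal_fn Q 1 p > 0" "normal_fn Q 1 q < 0"
proof -
  have "\<exists>p. normal_fn Q 1 p > 0" using normal_fn_sgn_imp_0[of "-1" Q t] assms by (auto simp: not_less[symmetric])
  moreover have "\<exists>q. normal_fn Q 1 q < 0" using normal_fn_sgn_imp_0[of 1 Q t] assms by (auto simp: not_less[symmetric])
  ultimately show ?thesis using that by blast
qed

text \<open>Of the two arcs between a point where \<open>normal_fn Q 1\<close> is positive and one where it is negative,
  one contains two of the three zeros.\<close>

lemma three_arrange:
  assumes "three_normals Q" "normal_fn Q 1 t \<noteq> 0"
  obtains x a b y where "x < a" "a < b" "b < y" "y < x + \<tau>"
    "normal_fn Q 1 a = 0" "normal_fn Q 1 b = 0" "normal_fn Q 1 x * normal_fn Q 1 y < 0"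
proof -
  obtain p q0 where p: "normal_fn Q 1 p > 0" and q0: "normal_fn Q 1 q0 < 0" using both_signs assms(2) by blast
  obtain t1 t2 t3 where t: "t1 < t2" "t2 < t3" "t3 < t1 + \<tau>"
    "normal_fn Q 1 t1 = 0" "normal_fn Q 1 t2 = 0" "normal_fn Q 1 t3 = 0"
    using assms(1) unfolding three_normals_def by blast
  \<comment> \<open>Cyclic rotation of the zeros so that a positive point precedes all three within
    a period; one case for each arc that may contain it.\<close>
  obtain s1 s2 s3 p' where s: "p' < s1" "s1 < s2" "s2 < s3" "s3 < p' + \<tau>" "normal_fn Q 1 p' > 0"
    "normal_fn Q 1 s1 = 0" "normal_fn Q 1 s2 = 0" "normal_fn Q 1 s3 = 0"
  proof -
    obtain k :: int where k: "t1 \<le> p + of_int k * \<tau>" "p + of_int k * \<tau> < t1 + \<tau>"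
      by (rule shift_into_period)
    define p' where "p' = p + of_int k * \<tau>"
    have p': "normal_fn Q 1 p' > 0" using p by (simp add: p'_def normal_fn_period)
    then have "p' \<noteq> t1" "p' \<noteq> t2" "p' \<noteq> t3" using t by auto
    then consider "t1 < p'" "p' < t2" | "t2 < p'" "p' < t3" | "t3 < p'" "p' < t1 + \<tau>"
      using k unfolding p'_def[symmetric] by linarith
    then show ?thesis
    proof cases
      case 1 then show ?thesis using that[of p' t2 t3 "t1 + \<tau>"] t p' by (simp add: normal_fn_period1)
    next
      case 2 then show ?thesis using that[of p' t3 "t1 + \<tau>" "t2 + \<tau>"] t p' by (simp add: normal_fn_period1)
    next
      case 3 then show ?thesis using that[of p' "t1 + \<tau>" "t2 + \<tau>" "t3 + \<tau>"] t p' by (simp add: normal_fn_period1)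
    qed
  qed
  obtain k :: int where k: "p' \<le> q0 + of_int k * \<tau>" "q0 + of_int k * \<tau> < p' + \<tau>"
    by (rule shift_into_period)
  define q where "q = q0 + of_int k * \<tau>"
  have q: "normal_fn Q 1 q < 0" "p' \<le> q" "q < p' + \<tau>" using q0 k by (simp_all add: q_def normal_fn_period)
  show ?thesis
  \<comment> \<open>Beyond \<open>s2\<close>, the zeros \<open>s1\<close> and \<open>s2\<close> lie
    between \<open>p'\<close> and \<open>q\<close>; before it, \<open>s2\<close> and
    \<open>s3\<close> lie between \<open>q\<close> and \<open>p' + \<tau>\<close>.\<close>
  proof (cases "q > s2")
    case True
    then show ?thesis using that[of p' s1 s2 q] s q by (simp add: mult_pos_neg)
  next
    case False
    then have "q < s2" "p' < q" using q s by (auto simp: less_le)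
    then show ?thesis using that[of q s2 s3 "p' + \<tau>"] s q by (simp add: mult_neg_pos normal_fn_period1)
  qed
qed

lemma four_if_alternating:
  assumes "x < a" "a < b" "b < y" "y < x + \<tau>"
    and "normal_fn Q 1 x * normal_fn Q 1 a < 0" "normal_fn Q 1 a * normal_fn Q 1 b < 0" "normal_fn Q 1 b * normal_fn Q 1 y < 0"
  shows "four_normals Q 1"
proof -
  \<comment> \<open>Three sign changes leave opposite signs at \<open>x\<close> and
    \<open>y\<close>, so periodicity forces a fourth change between \<open>y\<close> and
    \<open>x + \<tau>\<close>.\<close>
  have y: "normal_fn Q 1 y * normal_fn Q 1 (x + \<tau>) < 0"
    using assms(5-7) by (auto simp: normal_fn_period1 mult_less_0_iff)
  obtain t1 where t1: "x < t1" "t1 < a" "normal_fn Q 1 t1 = 0"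
    using IVT_strict[OF assms(1) continuous_fn assms(5)] by blast
  obtain t2 where t2: "a < t2" "t2 < b" "normal_fn Q 1 t2 = 0"
    using IVT_strict[OF assms(2) continuous_fn assms(6)] by blast
  obtain t3 where t3: "b < t3" "t3 < y" "normal_fn Q 1 t3 = 0"
    using IVT_strict[OF assms(3) continuous_fn assms(7)] by blast
  obtain t4 where t4: "y < t4" "t4 < x + \<tau>" "normal_fn Q 1 t4 = 0"
    using IVT_strict[OF assms(4) continuous_fn y] by blast
  show ?thesis unfolding four_normals_def
    by (rule exI[of _ t1], rule exI[of _ t2], rule exI[of _ t3], rule exI[of _ t4])
      (use t1 t2 t3 t4 in auto)
qed

lemma continuous_fn_point: "continuous_on UNIV (\<lambda>Q. normal_fn Q s t)"
  unfolding normal_fn_def by (intro continuous_intros)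

text \<open>\<open>normal_fn\<close> is affine in the point with gradient \<open>d1 t\<close>. A
  small displacement along \<open>v\<close> makes the values at \<open>x\<close>, \<open>a\<close>,
  \<open>b\<close>, \<open>y\<close> alternate in sign, which is an open condition.\<close>

lemma three_imp_closure_four:
  assumes "three_normals Q" "normal_fn Q 1 t \<noteq> 0"
  shows "Q \<in> closure ({P. four_normals P 1} - caustic \<gamma>)"
proof -
  obtain x a b y where *: "x < a" "a < b" "b < y" "y < x + \<tau>"
    "normal_fn Q 1 a = 0" "normal_fn Q 1 b = 0" "normal_fn Q 1 x * normal_fn Q 1 y < 0"
    using three_arrange[OF assms] by blast
  define W where "W = {P. normal_fn P 1 x * normal_fn P 1 a < 0 \<and> normal_fn P 1 a * normal_fn P 1 b < 0 \<and> normal_fn P 1 b * normal_fn P 1 y < 0}"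
  have "open W" unfolding W_def
    by (intro open_Collect_conj open_Collect_less continuous_intros continuous_fn_point)
  have "W \<subseteq> {P. four_normals P 1}" using four_if_alternating[OF *(1-4)] by (auto simp: W_def)
  \<comment> \<open>The factor \<open>normal_fn Q 1 x\<close> orients the displacement: the new
    value at \<open>a\<close> gets the sign opposite to that at \<open>x\<close>, and the new value
    at \<open>b\<close> the sign opposite to that at \<open>y\<close>.\<close>
  define v where "v = normal_fn Q 1 x *\<^sub>R (sgn (d1 b) - sgn (d1 a))"
  have sg: "(sgn (d1 b) - sgn (d1 a)) \<bullet> d1 b > 0" "(sgn (d1 b) - sgn (d1 a)) \<bullet> d1 a < 0"
    using sgn_diff_inner[OF d1_nz d1_nz sgn_tangent_neq[of a b]] * by auto
  have fv: "normal_fn (Q + e *\<^sub>R v) 1 t = normal_fn Q 1 t + e * (v \<bullet> d1 t)" for e t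
    by (simp add: normal_fn_def algebra_simps inner_add_left inner_diff_left)
  have "\<forall>\<^sub>F e in at_right 0. Q + e *\<^sub>R v \<in> W"
  proof -
    have e0: "((\<lambda>e. normal_fn (Q + e *\<^sub>R v) 1 t) \<longlongrightarrow> normal_fn Q 1 t) (at_right (0::real))" for t
      unfolding fv by (auto intro!: tendsto_eq_intros)
    have pos: "normal_fn Q 1 x * normal_fn Q 1 x > 0" and neg: "normal_fn Q 1 y * normal_fn Q 1 x < 0"
      using * by (auto simp: mult.commute mult_less_0_iff zero_less_mult_iff)
    have "\<forall>\<^sub>F e in at_right (0::real). normal_fn (Q + e *\<^sub>R v) 1 x * normal_fn Q 1 x > 0"
      by (rule order_tendstoD(1)[OF _ pos]) (intro tendsto_intros e0)
    moreover have "\<forall>\<^sub>F e in at_right (0::real). normal_fn (Q + e *\<^sub>R v) 1 y * normal_fn Q 1 x < 0"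
      by (rule order_tendstoD(2)[OF _ neg]) (intro tendsto_intros e0)
    moreover have "\<forall>\<^sub>F e in at_right (0::real). e > 0" by (simp add: eventually_at_right_less)
    ultimately show ?thesis
    proof eventually_elim
      case (elim e)
      have "normal_fn (Q + e *\<^sub>R v) 1 a = normal_fn Q 1 x * (e * ((sgn (d1 b) - sgn (d1 a)) \<bullet> d1 a))"
        "normal_fn (Q + e *\<^sub>R v) 1 b = normal_fn Q 1 x * (e * ((sgn (d1 b) - sgn (d1 a)) \<bullet> d1 b))"
        unfolding fv using * by (simp_all add: v_def)
      moreover have "e * ((sgn (d1 b) - sgn (d1 a)) \<bullet> d1 a) < 0" "e * ((sgn (d1 b) - sgn (d1 a)) \<bullet> d1 b) > 0"
        using sg elim by (simp_all add: mult_pos_neg)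
      ultimately show ?case using elim unfolding W_def
        by (auto simp: mult_less_0_iff zero_less_mult_iff)
    qed
  qed
  then have "\<forall>\<^sub>F e in at_right 0. Q + e *\<^sub>R v \<in> closure W"
    by (rule eventually_mono) (use closure_subset[of W] in blast)
  moreover have "((\<lambda>e. Q + e *\<^sub>R v) \<longlongrightarrow> Q) (at_right (0::real))"
    by (auto intro!: tendsto_eq_intros)
  ultimately have "Q \<in> closure W"
    by (rule Lim_in_closed_set[OF closed_closure _ trivial_limit_at_right_real])
  \<comment> \<open>The caustic has empty interior, so removing it from the open set
    \<open>W\<close> leaves a dense part.\<close>
  moreover have "W \<subseteq> closure (W - caustic \<gamma>)"
  proof
    fix P assume P: "P \<in> W"
    show "P \<in> closure (W - caustic \<gamma>)"
    proof (rule ccontr)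
      assume nc: "P \<notin> closure (W - caustic \<gamma>)"
      have "open (W \<inter> - closure (W - caustic \<gamma>))" using \<open>open W\<close> by auto
      moreover have "W \<inter> - closure (W - caustic \<gamma>) \<subseteq> caustic \<gamma>"
        using closure_subset[of "W - caustic \<gamma>"] by blast
      ultimately have "W \<inter> - closure (W - caustic \<gamma>) \<subseteq> interior (caustic \<gamma>)"
        by (rule interior_maximal[rotated])
      then show False using P nc interior_caustic by blast
    qed
  qed
  ultimately have "Q \<in> closure (W - caustic \<gamma>)"
    using closure_minimal[OF _ closed_closure, of W] by blast
  then show ?thesis using closure_mono[of "W - caustic \<gamma>" "{P. four_normals P 1} - caustic \<gamma>"]
      \<open>W \<subseteq> {P. four_normals P 1}\<close> by blast
qed

section \<open>Limits of quadruples of normals, and boundedness\<close>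

lemma tendsto_fn:
  assumes "U \<longlonglongrightarrow> u" "S \<longlonglongrightarrow> s" "a \<longlonglongrightarrow> t"
  shows "(\<lambda>n. normal_fn (U n) (S n) (a n)) \<longlonglongrightarrow> normal_fn u s t"
    and "(\<lambda>n. normal_fn' (U n) (S n) (a n)) \<longlonglongrightarrow> normal_fn' u s t"
proof -
  have L: "(\<lambda>n. \<gamma> (a n)) \<longlonglongrightarrow> \<gamma> t" "(\<lambda>n. d1 (a n)) \<longlonglongrightarrow> d1 t" "(\<lambda>n. d2 (a n)) \<longlonglongrightarrow> d2 t"
    using continuous_on_tendsto_compose[OF continuous_\<gamma> assms(3)]
      continuous_on_tendsto_compose[OF continuous_d1 assms(3)]
      continuous_on_tendsto_compose[OF continuous_d2 assms(3)] by simp_all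
  show "(\<lambda>n. normal_fn (U n) (S n) (a n)) \<longlonglongrightarrow> normal_fn u s t"
    unfolding normal_fn_def by (intro tendsto_intros assms L)
  show "(\<lambda>n. normal_fn' (U n) (S n) (a n)) \<longlonglongrightarrow> normal_fn' u s t"
    unfolding normal_fn'_def by (intro tendsto_intros assms L)
qed

lemma tendsto_fn_zero:
  assumes "U \<longlonglongrightarrow> u" "S \<longlonglongrightarrow> s" "a \<longlonglongrightarrow> t" "\<And>n. normal_fn (U n) (S n) (a n) = 0"
  shows "normal_fn u s t = 0"
  using tendsto_fn(1)[OF assms(1-3)] unfolding assms(4) by (simp add: LIMSEQ_const_iff)

text \<open>Between two merging zeros the mean value theorem gives a zero of
  \<open>normal_fn'\<close>, which is squeezed to the same limit.\<close>

lemma coalescing_zeros: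
  assumes "U \<longlonglongrightarrow> u" "S \<longlonglongrightarrow> s" "a \<longlonglongrightarrow> t" "b \<longlonglongrightarrow> t" "\<And>n. a n < b n"
    and "\<And>n. normal_fn (U n) (S n) (a n) = 0" "\<And>n. normal_fn (U n) (S n) (b n) = 0"
  shows "normal_fn' u s t = 0"
proof -
  have "\<exists>z. a n < z \<and> z < b n \<and> normal_fn' (U n) (S n) z = 0" for n
  proof -
    obtain z where "a n < z" "z < b n"
      "normal_fn (U n) (S n) (b n) - normal_fn (U n) (S n) (a n) = (b n - a n) * normal_fn' (U n) (S n) z"
      using MVT2[OF assms(5)[of n], of "normal_fn (U n) (S n)" "normal_fn' (U n) (S n)"] normal_fn_deriv by blast
    then show ?thesis using assms(5)[of n] by (intro exI[of _ z]) (simp add: assms(6,7))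
  qed
  then obtain z where z: "\<And>n. a n < z n \<and> z n < b n \<and> normal_fn' (U n) (S n) (z n) = 0" by metis
  have "z \<longlonglongrightarrow> t"
    by (rule real_tendsto_sandwich[OF _ _ assms(3,4)]) (use z in \<open>auto intro!: always_eventually less_imp_le\<close>)
  from tendsto_fn(2)[OF assms(1,2) this] show ?thesis
    using z by (simp add: LIMSEQ_const_iff)
qed

text \<open>Fixing the period of the first foot confines all quadruples to a compact box.\<close>

lemma four_shift:
  assumes "four_normals u s"
  shows "\<exists>t1 t2 t3 t4. 0 \<le> t1 \<and> t1 < \<tau> \<and> t1 < t2 \<and> t2 < t3 \<and> t3 < t4 \<and> t4 < t1 + \<tau> \<and>
     normal_fn u s t1 = 0 \<and> normal_fn u s t2 = 0 \<and> normal_fn u s t3 = 0 \<and> normal_fn u s t4 = 0"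
proof -
  obtain t1 t2 t3 t4 where t: "t1 < t2" "t2 < t3" "t3 < t4" "t4 < t1 + \<tau>"
    "normal_fn u s t1 = 0" "normal_fn u s t2 = 0" "normal_fn u s t3 = 0" "normal_fn u s t4 = 0"
    using assms unfolding four_normals_def by blast
  obtain k :: int where k: "0 \<le> t1 + of_int k * \<tau>" "t1 + of_int k * \<tau> < 0 + \<tau>"
    by (rule shift_into_period)
  show ?thesis
    by (rule exI[of _ "t1 + of_int k * \<tau>"], rule exI[of _ "t2 + of_int k * \<tau>"],
        rule exI[of _ "t3 + of_int k * \<tau>"], rule exI[of _ "t4 + of_int k * \<tau>"])
      (use t k in \<open>simp add: normal_fn_period\<close>)
qed

text \<open>Compactness yields limits of the feet, and they stay distinct because merging feet would
  produce a multiple zero. With \<open>s = 1\<close> this gives closedness off the caustic, with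
  \<open>s = 0\<close> the behaviour at infinity.\<close>

lemma four_limit:
  assumes U: "U \<longlonglongrightarrow> u" and S: "S \<longlonglongrightarrow> s" and "\<And>n. four_normals (U n) (S n)"
    and simple: "\<And>t. normal_fn u s t = 0 \<Longrightarrow> normal_fn' u s t \<noteq> 0"
  shows "four_normals u s"
proof -
  have "\<forall>n. \<exists>t1 t2 t3 t4. 0 \<le> t1 \<and> t1 < \<tau> \<and> t1 < t2 \<and> t2 < t3 \<and> t3 < t4 \<and> t4 < t1 + \<tau> \<and>
     normal_fn (U n) (S n) t1 = 0 \<and> normal_fn (U n) (S n) t2 = 0 \<and> normal_fn (U n) (S n) t3 = 0 \<and> normal_fn (U n) (S n) t4 = 0"
    using four_shift assms(3) by simp
  then obtain t1 t2 t3 t4 where t: "\<And>n. 0 \<le> t1 n \<and> t1 n < \<tau> \<and> t1 n < t2 n \<and> t2 n < t3 n \<and>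
     t3 n < t4 n \<and> t4 n < t1 n + \<tau> \<and> normal_fn (U n) (S n) (t1 n) = 0 \<and> normal_fn (U n) (S n) (t2 n) = 0 \<and>
     normal_fn (U n) (S n) (t3 n) = 0 \<and> normal_fn (U n) (S n) (t4 n) = 0"
    unfolding choice_iff by blast
  define X where "X n = (t1 n, t2 n, t3 n, t4 n)" for n
  define K where "K = {0..2 * \<tau>} \<times> {0..2 * \<tau>} \<times> {0..2 * \<tau>} \<times> {0..2 * \<tau>}"
  have "X n \<in> K" for n
    using t[of n] by (simp add: X_def K_def)
  moreover have "compact K" unfolding K_def by (intro compact_Times compact_Icc)
  ultimately obtain l r where r: "strict_mono r" "(X \<circ> r) \<longlonglongrightarrow> l"
    unfolding compact_def by metis
  obtain l1 l2 l3 l4 where l: "l = (l1, l2, l3, l4)" by (cases l) auto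
  have L: "(\<lambda>n. t1 (r n)) \<longlonglongrightarrow> l1" "(\<lambda>n. t2 (r n)) \<longlonglongrightarrow> l2" "(\<lambda>n. t3 (r n)) \<longlonglongrightarrow> l3"
    "(\<lambda>n. t4 (r n)) \<longlonglongrightarrow> l4"
    using tendsto_fst[OF r(2)] tendsto_fst[OF tendsto_snd[OF r(2)]]
      tendsto_fst[OF tendsto_snd[OF tendsto_snd[OF r(2)]]]
      tendsto_snd[OF tendsto_snd[OF tendsto_snd[OF r(2)]]]
    by (simp_all add: X_def l o_def)
  \<comment> \<open>The shifted first foot is followed as a fifth zero, since the last foot might
    merge with it across the period.\<close>
  then have L1: "(\<lambda>n. t1 (r n) + \<tau>) \<longlonglongrightarrow> l1 + \<tau>" by (intro tendsto_intros)
  have U': "(\<lambda>n. U (r n)) \<longlonglongrightarrow> u" and S': "(\<lambda>n. S (r n)) \<longlonglongrightarrow> s"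
    using LIMSEQ_subseq_LIMSEQ[OF U r(1)] LIMSEQ_subseq_LIMSEQ[OF S r(1)] by (simp_all add: o_def)
  have Z: "normal_fn (U (r n)) (S (r n)) (t1 (r n)) = 0" "normal_fn (U (r n)) (S (r n)) (t2 (r n)) = 0"
    "normal_fn (U (r n)) (S (r n)) (t3 (r n)) = 0" "normal_fn (U (r n)) (S (r n)) (t4 (r n)) = 0"
    "normal_fn (U (r n)) (S (r n)) (t1 (r n) + \<tau>) = 0" for n
    using t[of "r n"] by (simp_all add: normal_fn_period1)
  have zl: "normal_fn u s l1 = 0" "normal_fn u s l2 = 0" "normal_fn u s l3 = 0" "normal_fn u s l4 = 0"
    using tendsto_fn_zero[OF U' S' L(1) Z(1)] tendsto_fn_zero[OF U' S' L(2) Z(2)]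
      tendsto_fn_zero[OF U' S' L(3) Z(3)] tendsto_fn_zero[OF U' S' L(4) Z(4)] by auto
  have less: "p < q" if "(\<lambda>n. a n) \<longlonglongrightarrow> p" "(\<lambda>n. b n) \<longlonglongrightarrow> q" "\<And>n. a n < b n" "normal_fn u s p = 0"
    "\<And>n. normal_fn (U (r n)) (S (r n)) (a n) = 0" "\<And>n. normal_fn (U (r n)) (S (r n)) (b n) = 0" for a b p q
  proof -
    have "p \<le> q" using that(1,2) by (rule LIMSEQ_le) (use that(3) less_imp_le in blast)
    moreover have "p \<noteq> q"
      using coalescing_zeros[OF U' S' that(1) _ that(3) that(5) that(6)] that(2) simple[OF that(4)]
      by auto
    ultimately show ?thesis by simp
  qed
  have "l1 < l2" using L(1,2) by (rule less) (use t Z zl in auto)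
  moreover have "l2 < l3" using L(2,3) by (rule less) (use t Z zl in auto)
  moreover have "l3 < l4" using L(3,4) by (rule less) (use t Z zl in auto)
  moreover have "l4 < l1 + \<tau>" using L(4) L1 by (rule less) (use t Z zl in auto)
  ultimately show ?thesis unfolding four_normals_def using zl by blast
qed

lemma four_closure:
  assumes "Q \<in> closure {P. four_normals P 1}" "Q \<notin> caustic \<gamma>"
  shows "four_normals Q 1"
proof -
  obtain U where "\<And>n. U n \<in> {P. four_normals P 1}" "U \<longlonglongrightarrow> Q"
    using assms(1) unfolding closure_sequential by blast
  then show ?thesis using four_limit[of U Q "\<lambda>_. 1" 1] assms(2) caustic_iff by auto
qed

text \<open>Points escaping to infinity, rescaled to norm 1, converge to a direction
  \<open>u\<close> at \<open>s = 0\<close>, where feet are the parameters with tangent orthogonal to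
  \<open>u\<close>. These zeros are simple because \<open>d1\<close> and \<open>d2\<close> are
  independent, so four of them survive; but only two unit tangents are orthogonal to
  \<open>u\<close>, and each occurs once per period.\<close>

lemma bounded_four: "bounded {P. four_normals P 1}"
proof (rule ccontr)
  assume "\<not> ?thesis"
  then have "\<forall>n. \<exists>P. four_normals P 1 \<and> norm P > real (Suc n)"
    unfolding bounded_iff by (auto simp: not_le)
  then obtain P where P: "\<And>n. four_normals (P n) 1" "\<And>n. norm (P n) > real (Suc n)" by metis
  have pos: "norm (P n) > 0" for n using P(2)[of n] of_nat_0_le_iff[of "Suc n", where 'a = real] by linarith
  define U where "U n = P n /\<^sub>R norm (P n)" for n
  define S where "S n = 1 / norm (P n)" for n
  have normal_fn: "normal_fn (U n) (S n) t = normal_fn (P n) 1 t / norm (P n)" for n t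
    by (simp add: normal_fn_def U_def S_def inner_diff_left divide_inverse algebra_simps)
  have f: "four_normals (U n) (S n)" for n
    using P(1)[of n] unfolding four_normals_def normal_fn using pos[of n] by simp
  have "U n \<in> sphere 0 1" for n using pos[of n] by (simp add: U_def)
  then obtain u r where u: "u \<in> sphere 0 1" "strict_mono r" "(U \<circ> r) \<longlonglongrightarrow> u"
    using compact_sphere[of "0::real^2" 1] unfolding compact_def by metis
  have "S \<longlonglongrightarrow> 0"
  proof (rule real_tendsto_sandwich[OF _ _ tendsto_const LIMSEQ_inverse_real_of_nat])
    show "\<forall>\<^sub>F n in sequentially. 0 \<le> S n" by (simp add: S_def)
    have "S n \<le> inverse (real (Suc n))" for n
      using le_imp_inverse_le[of "real (Suc n)" "norm (P n)"] P(2)[of n]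
      unfolding S_def inverse_eq_divide by simp
    then show "\<forall>\<^sub>F n in sequentially. S n \<le> inverse (real (Suc n))" by simp
  qed
  then have "(S \<circ> r) \<longlonglongrightarrow> 0" using LIMSEQ_subseq_LIMSEQ u(2) by blast
  moreover have u0: "u \<noteq> 0" using u(1) by auto
  moreover have "normal_fn' u 0 t \<noteq> 0" if "normal_fn u 0 t = 0" for t
    using orthogonal_two_imp_0[of u "d1 t" "d2 t"] nonflat[of t] that u0 by (auto simp: normal_fn_def normal_fn'_def)
  ultimately have "four_normals u 0"
    using four_limit[OF u(3)] f by simp
  then obtain t1 t2 t3 t4 where t: "t1 < t2" "t2 < t3" "t3 < t4" "t4 < t1 + \<tau>"
    "u \<bullet> d1 t1 = 0" "u \<bullet> d1 t2 = 0" "u \<bullet> d1 t3 = 0"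
    unfolding four_normals_def normal_fn_def by auto
  have s: "sgn (d1 t) = sgn (rot90 u) \<or> sgn (d1 t) = - sgn (rot90 u)" if tz: "u \<bullet> d1 t = 0" for t
  proof -
    obtain q where q: "d1 t = q *\<^sub>R rot90 u"
      using orthogonal_imp_multiple_rot90[of "d1 t" u] tz u0 by (auto simp: inner_commute)
    then have "q \<noteq> 0" using d1_nz[of t] by auto
    then show ?thesis by (cases "q > 0") (simp_all add: q sgn_scaleR)
  qed
  show False
    using s[OF t(5)] s[OF t(6)] s[OF t(7)] sgn_tangent_neq[of t1 t2] sgn_tangent_neq[of t2 t3]
      sgn_tangent_neq[of t1 t3] t by auto
qed

section \<open>Stability of four normals off the caustic\<close>

lemma simple_zero_persists:
  assumes "normal_fn Q 1 t = 0" "normal_fn' Q 1 t \<noteq> 0" "d > 0"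
  shows "\<forall>\<^sub>F P in nhds Q. \<exists>z. \<bar>z - t\<bar> < d \<and> normal_fn P 1 z = 0"
proof -
  \<comment> \<open>The factor makes the derivative at \<open>t\<close> a positive square, so
    \<open>g\<close> increases through 0. The resulting strict sign change between
    \<open>t - h\<close> and \<open>t + h\<close> persists for nearby points.\<close>
  define g where "g s = normal_fn' Q 1 t * normal_fn Q 1 s" for s
  have g: "(g has_real_derivative normal_fn' Q 1 t * normal_fn' Q 1 t) (at t)"
    unfolding g_def[abs_def] by (rule DERIV_cmult[OF normal_fn_deriv])
  have pos: "normal_fn' Q 1 t * normal_fn' Q 1 t > 0" using assms(2) not_real_square_gt_zero by blast
  obtain e1 where e1: "e1 > 0" "\<And>h. 0 < h \<Longrightarrow> h < e1 \<Longrightarrow> g t < g (t + h)"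
    using DERIV_pos_inc_right[OF g pos] by blast
  obtain e2 where e2: "e2 > 0" "\<And>h. 0 < h \<Longrightarrow> h < e2 \<Longrightarrow> g (t - h) < g t"
    using DERIV_pos_inc_left[OF g pos] by blast
  define h where "h = min d (min e1 e2) / 2"
  have h: "h > 0" "h < e1" "h < e2" "h < d" using e1 e2 assms(3) by (auto simp: h_def)
  have "g (t - h) < 0" "0 < g (t + h)"
    using e1(2)[of h] e2(2)[of h] h assms(1) by (auto simp: g_def)
  then have "normal_fn Q 1 (t - h) * normal_fn Q 1 (t + h) < 0"
    by (auto simp: g_def mult_less_0_iff zero_less_mult_iff)
  moreover have "open {P. normal_fn P 1 (t - h) * normal_fn P 1 (t + h) < 0}"
    by (intro open_Collect_less continuous_intros continuous_fn_point)
  ultimately have "\<forall>\<^sub>F P in nhds Q. P \<in> {P. normal_fn P 1 (t - h) * normal_fn P 1 (t + h) < 0}"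
    by (intro eventually_nhds_in_open) simp_all
  then show ?thesis
  proof eventually_elim
    case (elim P)
    then obtain z where "t - h < z" "z < t + h" "normal_fn P 1 z = 0"
      using IVT_strict[OF _ continuous_fn, of "t - h" "t + h" P 1] h by auto
    then show ?case using h by (intro exI[of _ z]) auto
  qed
qed

lemma four_open:
  assumes "four_normals Q 1" "Q \<notin> caustic \<gamma>"
  shows "Q \<in> interior {P. four_normals P 1}"
proof -
  obtain t1 t2 t3 t4 where t: "t1 < t2" "t2 < t3" "t3 < t4" "t4 < t1 + \<tau>"
    and z: "normal_fn Q 1 t1 = 0" "normal_fn Q 1 t2 = 0" "normal_fn Q 1 t3 = 0" "normal_fn Q 1 t4 = 0"
    using assms(1) unfolding four_normals_def by blast
  \<comment> \<open>Half of the smallest cyclic gap between the feet: feet displaced by less than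
    \<open>d\<close> keep their cyclic order.\<close>
  define d where "d = min (min (t2 - t1) (t3 - t2)) (min (t4 - t3) (t1 + \<tau> - t4)) / 2"
  have d: "d > 0" "2 * d \<le> t2 - t1" "2 * d \<le> t3 - t2" "2 * d \<le> t4 - t3" "2 * d \<le> t1 + \<tau> - t4"
    using t by (auto simp: d_def)
  have ev: "\<forall>\<^sub>F P in nhds Q. \<exists>z. \<bar>z - t\<bar> < d \<and> normal_fn P 1 z = 0" if "normal_fn Q 1 t = 0" for t
    by (rule simple_zero_persists[OF that _ d(1)]) (use that assms(2) caustic_iff in blast)
  have "\<forall>\<^sub>F P in nhds Q. four_normals P 1"
    using ev[OF z(1)] ev[OF z(2)] ev[OF z(3)] ev[OF z(4)]
  proof eventually_elim
    case (elim P)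
    obtain z1 where z1: "\<bar>z1 - t1\<bar> < d" "normal_fn P 1 z1 = 0" using elim(1) by blast
    obtain z2 where z2: "\<bar>z2 - t2\<bar> < d" "normal_fn P 1 z2 = 0" using elim(2) by blast
    obtain z3 where z3: "\<bar>z3 - t3\<bar> < d" "normal_fn P 1 z3 = 0" using elim(3) by blast
    obtain z4 where z4: "\<bar>z4 - t4\<bar> < d" "normal_fn P 1 z4 = 0" using elim(4) by blast
    have "z1 < z2" using z1(1) z2(1) d(2) unfolding abs_less_iff by linarith
    moreover have "z2 < z3" using z2(1) z3(1) d(3) unfolding abs_less_iff by linarith
    moreover have "z3 < z4" using z3(1) z4(1) d(4) unfolding abs_less_iff by linarith
    moreover have "z4 < z1 + \<tau>" using z4(1) z1(1) d(5) unfolding abs_less_iff by linarith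
    ultimately show ?case unfolding four_normals_def using z1(2) z2(2) z3(2) z4(2) by blast
  qed
  then obtain N where "open N" "Q \<in> N" "\<forall>P\<in>N. four_normals P 1" unfolding eventually_nhds by blast
  then show ?thesis unfolding interior_def by blast
qed

text \<open>Off the caustic every point lies in the interior or in the exterior of the set of points
  with four normals. A connected component cannot meet both of these disjoint open sets.\<close>

lemma four_component:
  assumes "D \<in> components (- caustic \<gamma>)" "Q \<in> D" "four_normals Q 1" "P \<in> D"
  shows "four_normals P 1"
proof (rule ccontr)
  assume n: "\<not> four_normals P 1"
  have D: "D \<subseteq> - caustic \<gamma>" "connected D"
    using assms(1) in_components_subset in_components_connected by blast+
  define U where "U = interior {P. four_normals P 1}"
  define V where "V = - closure {P. four_normals P 1}"
  have "R \<in> U \<union> V" if "R \<in> D" for R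
  proof (cases "R \<in> closure {P. four_normals P 1}")
    case True
    have R: "R \<notin> caustic \<gamma>" using that D(1) by blast
    then show ?thesis using four_open[OF four_closure[OF True R] R] by (simp add: U_def)
  qed (simp add: V_def)
  then have cover: "D \<subseteq> U \<union> V" by (rule subsetI)
  have disj: "U \<inter> V \<inter> D = {}"
    using order_trans[OF interior_subset closure_subset, of "{P. four_normals P 1}"]
    unfolding U_def V_def by blast
  have "open U" "open V" unfolding U_def V_def by (simp_all add: open_Compl)
  then have "U \<inter> D = {} \<or> V \<inter> D = {}" using connectedD[OF D(2) _ _ disj cover] by blast
  moreover have "Q \<notin> caustic \<gamma>" "P \<notin> caustic \<gamma>" using D(1) assms(2,4) by blast+
  then have "Q \<in> U" "P \<in> V"
    using four_open[OF assms(3)] four_closure[of P] n unfolding U_def V_def by blast+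
  ultimately show False using assms(2,4) by blast
qed

end

section \<open>Singularities of the caustic\<close>

text \<open>Suppose the evolute stops at \<open>a\<close>. At nearby parameters where it moves, its direction is
  \<open>rot90 (d1 t)\<close>, so one component of the differential of \<open>\<phi>\<close> kills \<open>rot90 (d1 t)\<close>. In the limit
  that component, which is stationary at \<open>a\<close> to first order, kills \<open>rot90 (d1 a)\<close> and its
  derivative \<open>rot90 (d2 a)\<close>, hence vanishes. Which component of \<open>\<phi>\<close> vanishes may depend on the
  parameter.\<close>

lemma (in oval) chart_evolute_deriv_nonzero:
  assumes "open U" "evolute a \<in> U" "smooth_on U \<phi>"
    and zero: "\<And>t. evolute t \<in> U \<Longrightarrow> \<phi> (evolute t) $ 1 = 0 \<or> \<phi> (evolute t) $ 2 = (0::real)"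
    and lim: "a islimpt {t. evolute' t \<noteq> 0}"
    and surj: "\<And>i. \<exists>v. dir_deriv v \<phi> (evolute a) $ (i::2) \<noteq> 0"
  shows "evolute' a \<noteq> 0"
proof
  assume stop: "evolute' a = 0"
  define A where "A v x = frechet_derivative \<phi> (at x) v" for v x
  have A_eq: "dir_deriv v \<phi> = A v" for v by (simp add: dir_deriv_def A_def fun_eq_iff)
  have D: "(\<phi> has_derivative (\<lambda>v. A v x)) (at x)" if "x \<in> U" for x
    using smooth_on_differentiable(1)[OF assms(3,1) that] unfolding A_def
    by (simp add: frechet_derivative_works)
  have lin: "linear (\<lambda>v. A v x)" if "x \<in> U" for x
    using D[OF that] has_derivative_linear by blast
  define e1 :: "real^2" where "e1 = axis 1 1"
  define e2 :: "real^2" where "e2 = axis 2 1"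
  have v_eq: "v = v $ 1 *\<^sub>R e1 + v $ 2 *\<^sub>R e2" for v :: "real^2"
    by (simp add: vec_eq_iff forall_2 e1_def e2_def axis_def)
  have A_vec: "A v x = v $ 1 *\<^sub>R A e1 x + v $ 2 *\<^sub>R A e2 x" if "x \<in> U" for v x
  proof -
    have "A (v $ 1 *\<^sub>R e1 + v $ 2 *\<^sub>R e2) x = v $ 1 *\<^sub>R A e1 x + v $ 2 *\<^sub>R A e2 x"
      using linear_add[OF lin[OF that]] linear_scale[OF lin[OF that]] by simp
    then show ?thesis using v_eq[of v] by simp
  qed
  \<comment> \<open>The differential of the chart applied to \<open>rot90 (d1 t)\<close>, expanded
    in a fixed basis so that coefficients and partial derivatives are differentiated
    separately.\<close>
  define G where "G t = rot90 (d1 t) $ 1 *\<^sub>R A e1 (evolute t) + rot90 (d1 t) $ 2 *\<^sub>R A e2 (evolute t)" for t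
  \<comment> \<open>The evolute has velocity 0 at \<open>a\<close>, so by the chain rule the partial
    derivatives of the chart are stationary along it.\<close>
  have const: "((\<lambda>t. A e (evolute t)) has_vector_derivative 0) (at a)" for e
  proof -
    have "A e differentiable at (evolute a)"
      using smooth_on_differentiable(2)[OF assms(3,1,2)] by (simp add: A_eq)
    then obtain L where L: "(A e has_derivative L) (at (evolute a))" unfolding differentiable_def by blast
    have "(A e \<circ> evolute has_derivative L \<circ> (\<lambda>h. h *\<^sub>R 0)) (at a)"
      using evolute_deriv[of a] L unfolding stop has_vector_derivative_def by (rule diff_chain_at)
    moreover have "L 0 = 0" using L has_derivative_linear linear_0 by blast
    ultimately show ?thesis by (simp add: has_vector_derivative_def o_def)
  qed
  have G: "(G has_vector_derivative A (rot90 (d2 a)) (evolute a)) (at a)"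
  proof -
    have r: "((\<lambda>t. rot90 (d1 t) $ i) has_real_derivative rot90 (d2 a) $ i) (at a)" for i
      unfolding has_real_derivative_iff_has_vector_derivative
      by (intro bounded_linear.has_vector_derivative[OF bounded_linear_vec_nth]
          bounded_linear.has_vector_derivative[OF bounded_linear_rot90] d2)
    have "(G has_vector_derivative (rot90 (d1 a) $ 1 *\<^sub>R 0 + rot90 (d2 a) $ 1 *\<^sub>R A e1 (evolute a)) +
        (rot90 (d1 a) $ 2 *\<^sub>R 0 + rot90 (d2 a) $ 2 *\<^sub>R A e2 (evolute a))) (at a)"
      unfolding G_def[abs_def]
      by (intro has_vector_derivative_add has_vector_derivative_scaleR r const)
    then show ?thesis using A_vec[OF assms(2), of "rot90 (d2 a)"] by simp
  qed
  have Gi: "((\<lambda>t. G t $ i) has_real_derivative A (rot90 (d2 a)) (evolute a) $ i) (at a)" for i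
    using bounded_linear.has_vector_derivative[OF bounded_linear_vec_nth G]
    by (simp add: has_real_derivative_iff_has_vector_derivative)
  define N where "N = evolute -` U"
  have N: "open N" "a \<in> N"
    using continuous_open_vimage[OF assms(1)] continuous_evolute assms(2)
    by (auto simp: N_def continuous_on_eq_continuous_at)
  \<comment> \<open>Near \<open>t\<close> one or the other chart coordinate vanishes, so the zeros
    of one of them accumulate at \<open>t\<close> and its derivative along the evolute is 0
    there.\<close>
  have "G t $ 1 = 0 \<or> G t $ 2 = 0" if t: "t \<in> N" "evolute' t \<noteq> 0" for t
  proof -
    have "t islimpt N" using N(1) t(1) islimpt_UNIV[of t] by (simp add: open_imp_islimpt)
    moreover have "N \<subseteq> {t. \<phi> (evolute t) $ 1 = 0} \<union> {t. \<phi> (evolute t) $ 2 = 0}" using zero by (auto simp: N_def)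
    ultimately have "t islimpt {t. \<phi> (evolute t) $ 1 = 0} \<union> {t. \<phi> (evolute t) $ 2 = 0}" by (rule islimpt_subset)
    then have or: "t islimpt {t. \<phi> (evolute t) $ 1 = 0} \<or> t islimpt {t. \<phi> (evolute t) $ 2 = 0}"
      by (simp only: islimpt_Un)
    have tU: "evolute t \<in> U" using t(1) by (simp add: N_def)
    have "(\<phi> \<circ> evolute has_derivative (\<lambda>v. A v (evolute t)) \<circ> (\<lambda>h. h *\<^sub>R evolute' t)) (at t)"
      using evolute_deriv[of t] D[OF tU] unfolding has_vector_derivative_def by (rule diff_chain_at)
    then have "((\<lambda>t. \<phi> (evolute t)) has_vector_derivative A (evolute' t) (evolute t)) (at t)"
      using linear_scale[OF lin[OF tU]] by (simp add: has_vector_derivative_def o_def)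
    from bounded_linear.has_vector_derivative[OF bounded_linear_vec_nth this]
    have d: "((\<lambda>t. \<phi> (evolute t) $ i) has_real_derivative A (evolute' t) (evolute t) $ i) (at t)" for i
      by (simp add: has_real_derivative_iff_has_vector_derivative)
    have A0: "A (evolute' t) (evolute t) $ 1 = 0 \<or> A (evolute' t) (evolute t) $ 2 = 0"
      using or islimpt_zeros_imp_deriv_0(2)[OF d] by blast
    obtain q where q: "evolute' t = q *\<^sub>R rot90 (d1 t)"
      using orthogonal_imp_multiple_rot90[OF evolute'_orthogonal d1_nz] by blast
    then have "q \<noteq> 0" using t(2) by auto
    moreover have "A (evolute' t) (evolute t) = q *\<^sub>R G t"
      using linear_scale[OF lin[OF tU], of q "rot90 (d1 t)"] A_vec[OF tU, of "rot90 (d1 t)"]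
      by (simp add: q G_def)
    ultimately show ?thesis using A0 by simp
  qed
  then have sub: "N \<inter> {t. evolute' t \<noteq> 0} \<subseteq> {t. G t $ 1 = 0} \<union> {t. G t $ 2 = 0}" by blast
  have "a islimpt (N \<inter> {t. evolute' t \<noteq> 0})"
  proof (rule islimptI)
    fix T assume "a \<in> T" "open T"
    then have "a \<in> N \<inter> T" "open (N \<inter> T)" using N by auto
    from islimptE[OF lim this] show "\<exists>y\<in>N \<inter> {t. evolute' t \<noteq> 0}. y \<in> T \<and> y \<noteq> a" by blast
  qed
  from islimpt_subset[OF this sub] have "a islimpt {t. G t $ 1 = 0} \<or> a islimpt {t. G t $ 2 = 0}"
    by (simp only: islimpt_Un)
  then obtain i :: 2 where i: "a islimpt {t. G t $ i = 0}" by blast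
  \<comment> \<open>The vector representing the \<open>i\<close>-th component of the differential at
    \<open>evolute a\<close>.\<close>
  define w :: "real^2" where "w = vector [A e1 (evolute a) $ i, A e2 (evolute a) $ i]"
  have Aw: "A v (evolute a) $ i = w \<bullet> v" for v
    by (simp add: A_vec[OF assms(2), of v] w_def inner_vec2 vector_2 mult.commute)
  have "A (rot90 (d1 a)) (evolute a) $ i = 0"
    using islimpt_zeros_imp_deriv_0(1)[OF Gi i] A_vec[OF assms(2), of "rot90 (d1 a)"]
    by (simp add: G_def)
  then have "w \<bullet> rot90 (d1 a) = 0" by (simp add: Aw)
  moreover have "w \<bullet> rot90 (d2 a) = 0"
    using islimpt_zeros_imp_deriv_0(2)[OF Gi i] by (simp add: Aw)
  moreover have "rot90 (rot90 (d1 a)) \<bullet> rot90 (d2 a) \<noteq> 0" using nonflat[of a] by simp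
  ultimately have "w = 0" by (rule orthogonal_two_imp_0)
  then show False using surj[of i] by (auto simp: A_eq Aw)
qed

text \<open>Differentiating \<open>\<phi> \<circ> \<psi> = id\<close> at the image of
  \<open>Q\<close> gives the differential of \<open>\<phi>\<close> a right inverse, so no component
  of it vanishes.\<close>

lemma chart_surj:
  fixes \<phi> \<psi> :: "real^2 \<Rightarrow> real^2"
  assumes "open U" "Q \<in> U" "open V" "homeomorphism U V \<phi> \<psi>" "smooth_on U \<phi>" "smooth_on V \<psi>"
  shows "\<exists>v. dir_deriv v \<phi> Q $ i \<noteq> 0"
proof -
  have h: "\<phi> Q \<in> V" "\<psi> (\<phi> Q) = Q" "\<And>y. y \<in> V \<Longrightarrow> \<phi> (\<psi> y) = y"
    using assms(2,4) by (auto simp: homeomorphism_def)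
  obtain L where L: "(\<psi> has_derivative L) (at (\<phi> Q))"
    using smooth_on_differentiable(1)[OF assms(6,3) h(1)] unfolding differentiable_def by blast
  have D: "(\<phi> has_derivative (\<lambda>v. dir_deriv v \<phi> Q)) (at (\<psi> (\<phi> Q)))"
    using smooth_on_differentiable(1)[OF assms(5,1,2)] unfolding h(2) dir_deriv_def
    by (simp add: frechet_derivative_works)
  have "(\<phi> \<circ> \<psi> has_derivative (\<lambda>v. dir_deriv v \<phi> Q) \<circ> L) (at (\<phi> Q))"
    using L D by (rule diff_chain_at)
  then have "(id has_derivative (\<lambda>v. dir_deriv v \<phi> Q) \<circ> L) (at (\<phi> Q))"
    by (rule has_derivative_transform_within_open[OF _ assms(3) h(1)]) (simp add: h(3))
  then have "(\<lambda>v. dir_deriv v \<phi> Q) \<circ> L = id"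
    using has_derivative_unique has_derivative_id by blast
  then have "dir_deriv (L (axis i 1)) \<phi> Q = axis i 1"
    by (metis comp_apply id_apply)
  then show ?thesis by (intro exI[of _ "L (axis i 1)"]) (simp add: axis_def)
qed

section \<open>Points of the caustic with three normals\<close>

context oval
begin

text \<open>\<open>normal_fn\<close> takes the sign opposite to that near \<open>a\<close> at some
  \<open>q\<close>, which forces a zero on each side of \<open>q\<close>; with \<open>a\<close>
  these are three. The factor \<open>l\<close> treats minima and maxima together.\<close>

lemma three_if_extremum:
  assumes "normal_fn (evolute a) 1 a = 0" "d > 0" "\<And>t. t \<noteq> a \<Longrightarrow> \<bar>t - a\<bar> \<le> d \<Longrightarrow> 0 < l * normal_fn (evolute a) 1 t"
  shows "three_normals (evolute a)"
proof -
  have "normal_fn (evolute a) 1 (a + d) \<noteq> 0" "l \<noteq> 0" using assms(3)[of "a + d"] assms(2) by auto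
  then have "\<exists>q. l * normal_fn (evolute a) 1 q < 0"
    using both_signs[of "evolute a" "a + d"] by (metis linorder_neqE_linordered_idom mult_less_0_iff)
  then obtain q0 where q0: "l * normal_fn (evolute a) 1 q0 < 0" by blast
  obtain k :: int where k: "a \<le> q0 + of_int k * \<tau>" "q0 + of_int k * \<tau> < a + \<tau>"
    by (rule shift_into_period)
  define q where "q = q0 + of_int k * \<tau>"
  have q: "l * normal_fn (evolute a) 1 q < 0" "a \<le> q" "q < a + \<tau>" using q0 k by (simp_all add: q_def normal_fn_period)
  have "q \<noteq> a" using q(1) assms(1) by auto
  have "a + d < q"
  proof (rule ccontr)
    assume "\<not> ?thesis"
    then show False using assms(3)[of q] q \<open>q \<noteq> a\<close> by auto
  qed
  moreover have "q < a + \<tau> - d"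
  proof (rule ccontr)
    assume "\<not> ?thesis"
    then show False using assms(3)[of "q - \<tau>"] q by (auto simp: normal_fn_period1)
  qed
  moreover have p1: "0 < l * normal_fn (evolute a) 1 (a + d)" using assms(3)[of "a + d"] assms(2) by simp
  moreover have p2: "0 < l * normal_fn (evolute a) 1 (a - d)" using assms(3)[of "a - d"] assms(2) by simp
  moreover have p2': "normal_fn (evolute a) 1 (a + \<tau> - d) = normal_fn (evolute a) 1 (a - d)"
    using normal_fn_period1(1)[of "evolute a" 1 "a - d"] by (simp add: algebra_simps)
  moreover have s: "normal_fn (evolute a) 1 (a + d) * normal_fn (evolute a) 1 q < 0" "normal_fn (evolute a) 1 q * normal_fn (evolute a) 1 (a + \<tau> - d) < 0"
    using p1 p2 q(1) unfolding p2' by (auto simp: mult_less_0_iff zero_less_mult_iff)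
  ultimately obtain z1 z2 where "a + d < z1" "z1 < q" "normal_fn (evolute a) 1 z1 = 0"
    "q < z2" "z2 < a + \<tau> - d" "normal_fn (evolute a) 1 z2 = 0"
    using IVT_strict[OF _ continuous_fn s(1)] IVT_strict[OF _ continuous_fn s(2)] by metis
  then show ?thesis unfolding three_normals_def using assms(1,2)
    by (intro exI[of _ a] exI[of _ z1] exI[of _ z2]) auto
qed

text \<open>\<open>evolute' a\<close> is a nonzero multiple of \<open>rot90 (d1 a)\<close>, so
  \<open>normal_fn''\<close> is nonzero at \<open>a\<close> and the zero is an extremum.\<close>

lemma three_if_regular:
  assumes "evolute' a \<noteq> 0"
  shows "three_normals (evolute a)"
proof -
  have z: "normal_fn (evolute a) 1 a = 0" "normal_fn' (evolute a) 1 a = 0" using double_zero_iff[of "evolute a" a] by auto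
  obtain q where q: "evolute' a = q *\<^sub>R rot90 (d1 a)"
    using orthogonal_imp_multiple_rot90[OF evolute'_orthogonal d1_nz] by blast
  \<comment> \<open>Multiplication by its own second derivative at \<open>a\<close> turns the
    extremum into a minimum.\<close>
  define l where "l = normal_fn'' (evolute a) 1 a"
  have "l \<noteq> 0" using assms nonflat[of a] by (auto simp: l_def normal_fn''_evolute q)
  then have l: "l * normal_fn'' (evolute a) 1 a > 0" unfolding l_def using not_real_square_gt_zero by blast
  have d: "((\<lambda>t. l * normal_fn (evolute a) 1 t) has_real_derivative l * normal_fn' (evolute a) 1 t) (at t)" for t
    by (rule DERIV_cmult[OF normal_fn_deriv])
  have d': "((\<lambda>t. l * normal_fn' (evolute a) 1 t) has_real_derivative l * normal_fn'' (evolute a) 1 a) (at a)"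
    by (rule DERIV_cmult[OF normal_fn'_deriv])
  have z': "l * normal_fn' (evolute a) 1 a = 0" using z by simp
  obtain d where "d > 0"
    "\<And>t. t \<noteq> a \<Longrightarrow> \<bar>t - a\<bar> \<le> d \<Longrightarrow> l * normal_fn (evolute a) 1 a < l * normal_fn (evolute a) 1 t"
    using strict_local_min[of "\<lambda>t. l * normal_fn (evolute a) 1 t" "\<lambda>t. l * normal_fn' (evolute a) 1 t",
          OF d z' d' l] by blast
  then show ?thesis using three_if_extremum[of a d l] z by auto
qed

text \<open>Where the evolute rests, the curve is an arc of a circle and all normals along the arc
  meet in its center.\<close>

lemma three_if_locally_constant:
  assumes "\<not> a islimpt {t. evolute' t \<noteq> 0}" "evolute' a = 0"
  shows "three_normals (evolute a)"
proof -
  obtain T where T: "open T" "a \<in> T" "\<forall>t\<in>T. t \<noteq> a \<longrightarrow> evolute' t = 0"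
    using assms(1) unfolding islimpt_def by blast
  obtain e where e: "e > 0" "ball a e \<subseteq> T" by (rule openE[OF T(1,2)])
  have "evolute' t = 0" if "t \<in> ball a e" for t using that e T assms(2) by (cases "t = a") auto
  then have "(evolute has_derivative (\<lambda>h. 0)) (at t within ball a e)" if "t \<in> ball a e" for t
    using evolute_deriv[of t] that
    by (auto simp: has_vector_derivative_def intro: has_derivative_at_withinI)
  from has_derivative_zero_constant[OF convex_ball this]
  obtain k where k: "\<forall>t\<in>ball a e. evolute t = k" by blast
  have z: "normal_fn (evolute a) 1 t = 0" if "t \<in> ball a e" for t
  proof -
    have "evolute a = k" using k e by auto
    then have "evolute a = evolute t" using k that by auto
    then show ?thesis using double_zero_iff[of "evolute a" t] by simp
  qed
  define h where "h = min e \<tau> / 4"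
  have h: "h > 0" "2 * h < e" "2 * h < \<tau>" using e \<tau>_pos by (auto simp: h_def)
  show ?thesis unfolding three_normals_def
    by (rule exI[of _ a], rule exI[of _ "a + h"], rule exI[of _ "a + 2 * h"])
      (use h z in \<open>auto simp: dist_real_def\<close>)
qed

text \<open>Models inside the union of the axes cover regular points and crossings at once. A
  stationary parameter cannot be a limit of moving ones, by the chart argument, so it lies in a
  stretch where the evolute rests.\<close>

lemma noncusp_three:
  assumes "Q \<in> caustic \<gamma>" "locally_modelled_on M (caustic \<gamma>) Q" "\<And>p. p \<in> M \<Longrightarrow> p $ 1 = 0 \<or> p $ 2 = 0"
  shows "three_normals Q"
proof -
  obtain a where a: "Q = evolute a" using assms(1) caustic_eq by auto
  obtain U V \<phi> \<psi> where *: "open U" "Q \<in> U" "open V" "homeomorphism U V \<phi> \<psi>" "smooth_on U \<phi>"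
    "smooth_on V \<psi>" "\<phi> ` (caustic \<gamma> \<inter> U) = M \<inter> V"
    using assms(2) unfolding locally_modelled_on_def by metis
  have zero: "\<phi> (evolute t) $ 1 = 0 \<or> \<phi> (evolute t) $ 2 = 0" if "evolute t \<in> U" for t
  proof -
    have "evolute t \<in> caustic \<gamma> \<inter> U" using that by (simp add: caustic_eq)
    then have "\<phi> (evolute t) \<in> M" using *(7) by blast
    then show ?thesis using assms(3) by blast
  qed
  show ?thesis
  proof (cases "evolute' a = 0")
    case False
    then show ?thesis using three_if_regular a by simp
  next
    case True
    then have "\<not> a islimpt {t. evolute' t \<noteq> 0}"
      using chart_evolute_deriv_nonzero[OF *(1) _ *(5) zero] chart_surj[OF *(1-6)] *(2) a by blast
    then show ?thesis using three_if_locally_constant True a by simp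
  qed
qed

end

section \<open>Local components of the complement of the caustic\<close>

text \<open>This rules out that infinitely many components of the complement of \<open>S\<close> accumulate at \<open>x\<close>,
  in which case \<open>x\<close> could lie in the closure of their union but of none of them.\<close>

definition finitely_split :: "'a::topological_space set \<Rightarrow> 'a \<Rightarrow> bool" where
  "finitely_split S x \<longleftrightarrow> (\<exists>\<P> N. finite \<P> \<and> (\<forall>P\<in>\<P>. connected P \<and> P \<inter> S = {}) \<and>
     open N \<and> x \<in> N \<and> N \<subseteq> S \<union> \<Union>\<P>)"

abbreviation square :: "real \<Rightarrow> (real^2) set" where
  "square e \<equiv> cbox (vec (- e)) (vec e)"

lemma mem_sq: "p \<in> square e \<longleftrightarrow> - e \<le> p $ 1 \<and> p $ 1 \<le> e \<and> - e \<le> p $ 2 \<and> p $ 2 \<le> e"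
  by (auto simp: mem_box_cart forall_2)

lemma sq_in_open:
  assumes "open V" "(0::real^2) \<in> V"
  obtains e where "e > 0" "square e \<subseteq> V"
proof -
  obtain d where d: "d > 0" "ball 0 d \<subseteq> V" by (rule openE[OF assms])
  have "square (d / 3) \<subseteq> ball 0 d"
  proof
    fix p assume "p \<in> square (d / 3)"
    then have "\<bar>p $ 1\<bar> \<le> d / 3" "\<bar>p $ 2\<bar> \<le> d / 3" unfolding mem_sq by auto
    moreover have "norm p \<le> \<bar>p $ 1\<bar> + \<bar>p $ 2\<bar>" using norm_le_l1_cart[of p] by (simp add: sum_2)
    ultimately show "p \<in> ball 0 d" using d by simp
  qed
  then show ?thesis using that[of "d / 3"] d by auto
qed

text \<open>The pieces of a small square minus the model are carried back by \<open>\<psi>\<close>.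
  They avoid \<open>C\<close> because within the chart \<open>\<phi>\<close> matches
  \<open>C\<close> exactly with \<open>M\<close>.\<close>

lemma finitely_split_transfer:
  assumes "locally_modelled_on M C Q"
    and M: "\<And>e. e > 0 \<Longrightarrow> \<exists>\<P>. finite \<P> \<and> (\<forall>P\<in>\<P>. connected P) \<and> \<Union>\<P> = square e - M"
  shows "finitely_split C Q"
proof -
  obtain U V \<phi> \<psi> where *: "open U" "Q \<in> U" "open V" "0 \<in> V" "homeomorphism U V \<phi> \<psi>" "\<phi> Q = 0"
    "\<phi> ` (C \<inter> U) = M \<inter> V"
    using assms(1) unfolding locally_modelled_on_def by metis
  have h: "\<And>x. x \<in> U \<Longrightarrow> \<psi> (\<phi> x) = x" "continuous_on U \<phi>" "\<And>y. y \<in> V \<Longrightarrow> \<phi> (\<psi> y) = y" "\<psi> ` V = U"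
    "continuous_on V \<psi>"
    using *(5) unfolding homeomorphism_def by auto
  have M_iff: "x \<in> C \<longleftrightarrow> \<phi> x \<in> M" if "x \<in> U" "\<phi> x \<in> V" for x
  proof
    assume "x \<in> C"
    then have "\<phi> x \<in> \<phi> ` (C \<inter> U)" using that by blast
    then show "\<phi> x \<in> M" using *(7) by blast
  next
    assume "\<phi> x \<in> M"
    then have "\<phi> x \<in> \<phi> ` (C \<inter> U)" using *(7) that by blast
    then obtain y where "y \<in> C" "y \<in> U" "\<phi> x = \<phi> y" by blast
    then have "x = y" using h(1) that(1) by metis
    then show "x \<in> C" using \<open>y \<in> C\<close> by simp
  qed
  obtain e where e: "e > 0" "square e \<subseteq> V" using sq_in_open[OF *(3,4)] .
  obtain \<P> where P: "finite \<P>" "\<And>P. P \<in> \<P> \<Longrightarrow> connected P" "\<Union>\<P> = square e - M"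
    using M[OF e(1)] by blast
  define N where "N = U \<inter> \<phi> -` box (vec (- e)) (vec e)"
  have "open N" unfolding N_def
    using continuous_on_open_vimage[OF *(1)] h(2) open_box by (metis Int_commute)
  moreover have "Q \<in> N" using * e(1) by (simp add: N_def mem_box_cart)
  moreover have "N \<subseteq> C \<union> \<Union>((`) \<psi> ` \<P>)"
  proof
    fix x assume "x \<in> N"
    then have x: "x \<in> U" "\<phi> x \<in> square e" using box_subset_cbox by (auto simp: N_def)
    then have xV: "\<phi> x \<in> V" using e by blast
    show "x \<in> C \<union> \<Union>((`) \<psi> ` \<P>)"
    proof (cases "\<phi> x \<in> M")
      case True
      then show ?thesis using M_iff[OF x(1) xV] by blast
    next
      case False
      then have "\<phi> x \<in> \<Union>\<P>" using x P(3) by blast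
      then have "\<psi> (\<phi> x) \<in> \<Union>((`) \<psi> ` \<P>)" by blast
      then show ?thesis using h(1)[OF x(1)] by simp
    qed
  qed
  moreover have "connected P' \<and> P' \<inter> C = {}" if P': "P' \<in> (`) \<psi> ` \<P>" for P'
  proof -
    obtain P where PP: "P \<in> \<P>" "P' = \<psi> ` P" using P' by blast
    have PV: "P \<subseteq> V" "P \<inter> M = {}" using PP P(3) e by blast+
    have "connected P'"
      unfolding PP(2) by (rule connected_continuous_image[OF continuous_on_subset[OF h(5) PV(1)] P(2)[OF PP(1)]])
    moreover have "\<psi> y \<notin> C" if "y \<in> P" for y
    proof -
      have y: "y \<in> V" "y \<notin> M" using PV that by blast+
      then have "\<psi> y \<in> U" using h(4) by blast
      then show ?thesis using M_iff[of "\<psi> y"] h(3)[OF y(1)] y by simp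
    qed
    ultimately show ?thesis using PP(2) by blast
  qed
  ultimately show ?thesis unfolding finitely_split_def
    by (intro exI[of _ "(`) \<psi> ` \<P>"] exI[of _ N]) (use P(1) in blast)
qed

lemma convex_coord: "convex {p::real^2. 0 < p $ k}" "convex {p::real^2. p $ k < 0}"
proof -
  have "{p::real^2. 0 < p $ k} = {p. axis k 1 \<bullet> p > 0}" "{p::real^2. p $ k < 0} = {p. axis k 1 \<bullet> p < 0}"
    by (simp_all add: inner_axis')
  then show "convex {p::real^2. 0 < p $ k}" "convex {p::real^2. p $ k < 0}"
    by (simp_all add: convex_halfspace_gt convex_halfspace_lt)
qed

lemma regular_split:
  "\<exists>\<P>. finite \<P> \<and> (\<forall>P\<in>\<P>. connected P) \<and> \<Union>\<P> = square e - {p. p $ 2 = 0}"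
proof -
  define \<P> where "\<P> = {square e \<inter> {p. 0 < p $ 2}, square e \<inter> {p. p $ 2 < 0}}"
  have "\<forall>P\<in>\<P>. connected P"
    unfolding \<P>_def by (auto intro!: convex_connected convex_Int convex_coord)
  moreover have "\<Union>\<P> = square e - {p. p $ 2 = 0}" by (auto simp: \<P>_def)
  moreover have "finite \<P>" by (simp add: \<P>_def)
  ultimately show ?thesis by blast
qed

lemma crossing_split:
  "\<exists>\<P>. finite \<P> \<and> (\<forall>P\<in>\<P>. connected P) \<and> \<Union>\<P> = square e - {p. p $ 1 * p $ 2 = 0}"
proof -
  define \<P> where "\<P> = {square e \<inter> ({p. 0 < p $ 1} \<inter> {p. 0 < p $ 2}), square e \<inter> ({p. 0 < p $ 1} \<inter> {p. p $ 2 < 0}),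
    square e \<inter> ({p. p $ 1 < 0} \<inter> {p. 0 < p $ 2}), square e \<inter> ({p. p $ 1 < 0} \<inter> {p. p $ 2 < 0})}"
  have "\<forall>P\<in>\<P>. connected P"
    unfolding \<P>_def by (auto intro!: convex_connected convex_Int convex_coord)
  moreover have "\<Union>\<P> = square e - {p. p $ 1 * p $ 2 = 0}" by (auto simp: \<P>_def)
  moreover have "finite \<P>" by (simp add: \<P>_def)
  ultimately show ?thesis by blast
qed

text \<open>Both sides of the semicubical parabola in the square are starlike, seen from the
  opposite edge midpoints \<open>(e, 0)\<close> and \<open>(-e, 0)\<close>.\<close>

lemma cusp_split:
  assumes "e > 0"
  shows "\<exists>\<P>. finite \<P> \<and> (\<forall>P\<in>\<P>. connected P) \<and> \<Union>\<P> = square e - {p. (p $ 2)^2 = (p $ 1)^3}"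
proof -
  define A where "A = {p \<in> square e. (p $ 2)^2 < (p $ 1)^3}"
  define B where "B = {p \<in> square e. (p $ 1)^3 < (p $ 2)^2}"
  have seg: "p \<in> square e" if "p \<in> closed_segment a x" "a \<in> square e" "x \<in> square e" for p a x
    using that convex_contains_segment[of "square e"] convex_box by blast
  have "starlike A"
    unfolding starlike_def
  proof (intro bexI[of _ "vector [e, 0]"] ballI subsetI)
    show a: "vector [e, 0] \<in> A" using assms by (simp add: A_def mem_sq vector_2)
    fix x p assume x: "x \<in> A" and p: "p \<in> closed_segment (vector [e, 0]) x"
    then obtain u where u: "0 \<le> u" "u \<le> 1" "p = (1 - u) *\<^sub>R vector [e, 0] + u *\<^sub>R x"
      unfolding in_segment by blast
    then have pc: "p $ 1 = (1 - u) * e + u * x $ 1" "p $ 2 = u * x $ 2" by (simp_all add: vector_2)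
    have x': "x \<in> square e" "(x $ 2)^2 < (x $ 1)^3" using x by (simp_all add: A_def)
    then have "0 < (x $ 1) ^ 3" using zero_le_power2[of "x $ 2"] by linarith
    then have x1: "0 < x $ 1" by (simp add: zero_less_power_eq)
    have "x $ 1 \<le> e" using x'(1) unfolding mem_sq by blast
    \<comment> \<open>Moving towards \<open>(e, 0)\<close> does not decrease the first coordinate
      and shrinks the second in absolute value.\<close>
    then have "(1 - u) * (x $ 1) \<le> (1 - u) * e" using u by (intro mult_left_mono) auto
    then have "x $ 1 \<le> p $ 1" by (simp add: pc algebra_simps)
    then have "(x $ 1)^3 \<le> (p $ 1)^3" using x1 by (intro power_mono) auto
    moreover have "u^2 * (x $ 2)^2 \<le> (x $ 2)^2" using u by (simp add: mult_left_le_one_le power_le_one)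
    ultimately have "(p $ 2)^2 < (p $ 1)^3" using x'(2) by (simp add: pc(2) power_mult_distrib)
    moreover have "p \<in> square e" using seg[OF p] a x by (simp add: A_def)
    ultimately show "p \<in> A" by (simp add: A_def)
  qed
  moreover have "starlike B"
    unfolding starlike_def
  proof (intro bexI[of _ "vector [- e, 0]"] ballI subsetI)
    show a: "vector [- e, 0] \<in> B" using assms by (simp add: B_def mem_sq vector_2)
    fix x p assume x: "x \<in> B" and p: "p \<in> closed_segment (vector [- e, 0]) x"
    then obtain u where u: "0 \<le> u" "u \<le> 1" "p = (1 - u) *\<^sub>R vector [- e, 0] + u *\<^sub>R x"
      unfolding in_segment by blast
    then have pc: "p $ 1 = u * x $ 1 - (1 - u) * e" "p $ 2 = u * x $ 2" by (simp_all add: vector_2)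
    have x': "x \<in> square e" "(x $ 1)^3 < (x $ 2)^2" using x by (simp_all add: B_def)
    have "(p $ 1)^3 < (p $ 2)^2"
    proof (cases "u = 0")
      case True
      then show ?thesis using assms by (simp add: pc)
    next
      case False
      \<comment> \<open>The first coordinate is at most \<open>u * x $ 1\<close>, so its cube scales
        by \<open>u^3\<close>, whereas the square of the second scales by the larger
        \<open>u^2\<close>.\<close>
      have "(1 - u) * e \<ge> 0" using u assms by simp
      then have "p $ 1 \<le> u * x $ 1" by (simp add: pc)
      then have "(p $ 1)^3 \<le> (u * x $ 1)^3" by (rule power_mono_odd[rotated]) simp
      also have "\<dots> = u^3 * (x $ 1)^3" by (simp add: power_mult_distrib)
      also have "\<dots> < u^3 * (x $ 2)^2" using x'(2) False u by simp
      also have "\<dots> \<le> u^2 * (x $ 2)^2" using u by (intro mult_right_mono power_decreasing) auto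
      finally show ?thesis by (simp add: pc(2) power_mult_distrib)
    qed
    moreover have "p \<in> square e" using seg[OF p] a x by (simp add: B_def)
    ultimately show "p \<in> B" by (simp add: B_def)
  qed
  ultimately have "\<forall>P\<in>{A, B}. connected P" using starlike_imp_connected by auto
  moreover have "\<Union>{A, B} = square e - {p. (p $ 2)^2 = (p $ 1)^3}" unfolding A_def B_def by auto
  moreover have "finite {A, B}" by simp
  ultimately show ?thesis by blast
qed

lemma generic_finitely_split:
  assumes "generic_curve \<gamma>" "Q \<in> caustic \<gamma>"
  shows "finitely_split (caustic \<gamma>) Q"
proof -
  consider "locally_modelled_on {p. p $ 2 = 0} (caustic \<gamma>) Q"
    | "locally_modelled_on {p. (p $ 2)^2 = (p $ 1)^3} (caustic \<gamma>) Q"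
    | "locally_modelled_on {p. p $ 1 * p $ 2 = 0} (caustic \<gamma>) Q"
    using assms unfolding generic_curve_def regular_point_def cusp_def normal_crossing_def by blast
  then show ?thesis
    by cases (rule finitely_split_transfer, assumption, rule regular_split cusp_split crossing_split, assumption?)+
qed

text \<open>The chart sends a single point to the origin alone, while the path \<open>p\<close>
  provides other points of the model arbitrarily near it.\<close>

lemma not_modelled_on_singleton:
  assumes "locally_modelled_on M {Q} Q" "\<And>s. s > 0 \<Longrightarrow> p s \<in> M \<and> p s \<noteq> 0"
    and "(p \<longlongrightarrow> 0) (at_right (0::real))"
  shows False
proof -
  obtain U V \<phi> where *: "Q \<in> U" "open V" "0 \<in> V" "\<phi> Q = 0" "\<phi> ` ({Q} \<inter> U) = M \<inter> V"
    using assms(1) unfolding locally_modelled_on_def by metis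
  have "\<forall>\<^sub>F s in at_right 0. p s \<in> V"
    using topological_tendstoD[OF assms(3) *(2,3)] .
  moreover have "\<forall>\<^sub>F s in at_right (0::real). s > 0" by (simp add: eventually_at_right_less)
  ultimately have "\<forall>\<^sub>F s in at_right (0::real). s > 0 \<and> p s \<in> V" by eventually_elim simp
  then obtain s where "s > 0" "p s \<in> V"
    using eventually_happens trivial_limit_at_right_real by blast
  then have "p s \<in> M \<inter> V" "p s \<noteq> 0" using assms(2) by blast+
  then show False using *(1,4,5) by auto
qed

lemma generic_caustic_not_singleton:
  assumes "generic_curve \<gamma>"
  shows "caustic \<gamma> \<noteq> {Q}"
proof
  assume C: "caustic \<gamma> = {Q}"
  define p :: "real \<Rightarrow> real^2" where "p s = s *\<^sub>R axis 1 1" for s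
  \<comment> \<open>A parametrization of one branch of the cusp; the path \<open>p\<close> lies on
    the first axis, which belongs to both other models.\<close>
  define r :: "real \<Rightarrow> real^2" where "r s = s^2 *\<^sub>R axis 1 1 + s^3 *\<^sub>R axis 2 1" for s
  have lim: "(p \<longlongrightarrow> 0) (at_right 0)" "(r \<longlongrightarrow> 0) (at_right 0)"
    unfolding p_def[abs_def] r_def[abs_def] by (auto intro!: tendsto_eq_intros)
  have p: "p s $ 1 = s" "p s $ 2 = 0" and r: "r s $ 1 = s^2" "r s $ 2 = s^3" for s
    by (simp_all add: p_def r_def axis_def)
  have ne: "p s \<noteq> 0" "r s \<noteq> 0" if "s > 0" for s
    using that p[of s] r[of s] by auto
  consider "locally_modelled_on {p. p $ 2 = 0} {Q} Q"
    | "locally_modelled_on {p. (p $ 2)^2 = (p $ 1)^3} {Q} Q"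
    | "locally_modelled_on {p. p $ 1 * p $ 2 = 0} {Q} Q"
    using assms unfolding generic_curve_def regular_point_def cusp_def normal_crossing_def C by blast
  then show False
  proof cases
    case 1
    show False by (rule not_modelled_on_singleton[OF 1 _ lim(1)]) (simp add: p ne)
  next
    case 2
    show False by (rule not_modelled_on_singleton[OF 2 _ lim(2)]) (simp add: r ne flip: power_mult)
  next
    case 3
    show False by (rule not_modelled_on_singleton[OF 3 _ lim(1)]) (simp add: p ne)
  qed
qed

section \<open>Orthotricenters and the core\<close>

text \<open>Otherwise all normals pass through \<open>Q\<close>, as for a circle, and the caustic
  would be a single point.\<close>

lemma (in oval) generic_fn_nonzero:
  assumes "generic_curve \<gamma>"
  shows "\<exists>t. normal_fn Q 1 t \<noteq> 0"
proof (rule ccontr)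
  assume "\<not> ?thesis"
  then have z: "normal_fn Q 1 = (\<lambda>t. 0)" by auto
  have "normal_fn' Q 1 t = 0" for t
    using normal_fn_deriv[of Q 1 t] unfolding z by (rule DERIV_unique) (rule DERIV_const)
  then have "evolute t = Q" for t using double_zero_iff[of Q t] fun_cong[OF z, of t] by blast
  then have "caustic \<gamma> = {Q}" unfolding caustic_eq by auto
  then show False using generic_caustic_not_singleton[OF assms] by blast
qed

section \<open>Comparison of the orthotricenters with the core\<close>

locale generic_oval = oval +
  assumes generic: "generic_curve \<gamma>"
begin

abbreviation quadricenters :: "(real^2) set" where
  "quadricenters \<equiv> {P. four_normals P 1}"

lemma orthotricenters_subset: "orthotricenters \<gamma> \<subseteq> closure (quadricenters - caustic \<gamma>)"
proof
  fix Q assume "Q \<in> orthotricenters \<gamma>"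
  then have "three_normals Q" by (simp add: orthotricenters_iff)
  moreover obtain t where "normal_fn Q 1 t \<noteq> 0" using generic_fn_nonzero[OF generic] by blast
  ultimately show "Q \<in> closure (quadricenters - caustic \<gamma>)" by (rule three_imp_closure_four)
qed

lemma quadricenters_subset: "quadricenters \<subseteq> orthotricenters \<gamma>"
  using four_imp_three by (auto simp: orthotricenters_iff)

lemma closure_orthotricenters: "closure (orthotricenters \<gamma>) = closure (quadricenters - caustic \<gamma>)"
proof (rule antisym)
  show "closure (orthotricenters \<gamma>) \<subseteq> closure (quadricenters - caustic \<gamma>)"
    by (rule closure_minimal[OF orthotricenters_subset closed_closure])
  show "closure (quadricenters - caustic \<gamma>) \<subseteq> closure (orthotricenters \<gamma>)"
    by (rule closure_mono) (use quadricenters_subset in blast)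
qed

lemma bounded_orthotricenters: "bounded (orthotricenters \<gamma>)"
  by (rule bounded_subset[OF bounded_closure[OF bounded_subset[OF bounded_four]] orthotricenters_subset]) blast

lemma core_component_subset:
  assumes "\<forall>Q\<in>D. num_normals \<gamma> Q \<ge> 4"
  shows "D \<subseteq> orthotricenters \<gamma>"
  using assms num_normals_ge_4_imp_three by (auto simp: orthotricenters_iff)

text \<open>Four normals at one point propagate through the component, and off the caustic they are
  counted by \<open>num_normals\<close>.\<close>

lemma component_subset_core:
  assumes "D \<in> components (- caustic \<gamma>)" "Q \<in> D" "four_normals Q 1"
  shows "closure D \<subseteq> core \<gamma>"
proof -
  have "\<forall>P\<in>D. num_normals \<gamma> P \<ge> 4"
  proof
    fix P assume P: "P \<in> D"
    then have "P \<notin> caustic \<gamma>" using in_components_subset[OF assms(1)] by blast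
    then show "num_normals \<gamma> P \<ge> 4"
      using four_imp_num_normals_ge_4[OF four_component[OF assms P]] by blast
  qed
  then show ?thesis using assms(1) unfolding core_def by blast
qed

text \<open>A limit of orthotricenters off the caustic has four normals itself, so its own component
  lies in the core. On the caustic, finitely many local pieces approach it, and one of them contains
  points with four normals arbitrarily near it.\<close>

lemma core_eq: "core \<gamma> = closure (orthotricenters \<gamma>)"
proof (rule antisym)
  show "core \<gamma> \<subseteq> closure (orthotricenters \<gamma>)"
    unfolding core_def using closure_mono[OF core_component_subset] by blast
  show "closure (orthotricenters \<gamma>) \<subseteq> core \<gamma>"
  proof
    fix Q assume "Q \<in> closure (orthotricenters \<gamma>)"
    then have Q: "Q \<in> closure (quadricenters - caustic \<gamma>)" by (simp add: closure_orthotricenters)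
    show "Q \<in> core \<gamma>"
    proof (cases "Q \<in> caustic \<gamma>")
      case False
      have "Q \<in> closure quadricenters" using Q closure_mono[of "quadricenters - caustic \<gamma>" quadricenters] by blast
      then have Q4: "four_normals Q 1" using four_closure False by blast
      define D where "D = connected_component_set (- caustic \<gamma>) Q"
      have D: "D \<in> components (- caustic \<gamma>)" "Q \<in> D"
        using False by (simp_all add: D_def componentsI connected_component_refl_eq)
      show ?thesis using component_subset_core[OF D Q4] closure_subset[of D] D(2) by blast
    next
      case True
      obtain \<P> N where P: "finite \<P>" "\<forall>P\<in>\<P>. connected P \<and> P \<inter> caustic \<gamma> = {}"
        and N: "open N" "Q \<in> N" "N \<subseteq> caustic \<gamma> \<union> \<Union>\<P>"
        using generic_finitely_split[OF generic True] unfolding finitely_split_def by blast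
      have "Q \<in> closure (N \<inter> (quadricenters - caustic \<gamma>))"
        using open_Int_closure_subset[OF N(1), of "quadricenters - caustic \<gamma>"] N(2) Q by blast
      moreover have "N \<inter> (quadricenters - caustic \<gamma>) \<subseteq> (\<Union>P\<in>\<P>. closure (P \<inter> quadricenters))"
      proof
        fix R assume R: "R \<in> N \<inter> (quadricenters - caustic \<gamma>)"
        then obtain P where "P \<in> \<P>" "R \<in> P" using N(3) by blast
        then show "R \<in> (\<Union>P\<in>\<P>. closure (P \<inter> quadricenters))"
          using R closure_subset[of "P \<inter> quadricenters"] by blast
      qed
      \<comment> \<open>Finiteness of the family enters here: the limit point lies in the closure of
        one single piece.\<close>
      moreover have "closed (\<Union>P\<in>\<P>. closure (P \<inter> quadricenters))" using P(1) by (intro closed_UN) auto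
      ultimately have "Q \<in> (\<Union>P\<in>\<P>. closure (P \<inter> quadricenters))"
        by (meson closure_minimal subsetD)
      then obtain P where PP: "P \<in> \<P>" "Q \<in> closure (P \<inter> quadricenters)" by blast
      then have "P \<inter> quadricenters \<noteq> {}" by force
      then obtain R where R: "R \<in> P" "four_normals R 1" by blast
      define D where "D = connected_component_set (- caustic \<gamma>) R"
      have "R \<in> - caustic \<gamma>" using bspec[OF P(2) PP(1)] R(1) by blast
      then have D: "D \<in> components (- caustic \<gamma>)" "R \<in> D"
        by (simp_all add: D_def componentsI connected_component_refl_eq)
      have "P \<subseteq> D"
        using components_maximal[OF D(1), of P] bspec[OF P(2) PP(1)] R(1) D(2) by blast
      then have "Q \<in> closure D" using PP(2) closure_mono[of "P \<inter> quadricenters" D] by blast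
      then show ?thesis using component_subset_core[OF D R(2)] by blast
    qed
  qed
qed

text \<open>A component counted in the core consists of orthotricenters, which form a bounded set,
  so its closure is compact.\<close>

lemma core_subset_interior_region: "core \<gamma> \<subseteq> interior_region \<gamma>"
proof
  fix Q assume "Q \<in> core \<gamma>"
  then obtain D where D: "D \<in> components (- caustic \<gamma>)" "\<forall>Q\<in>D. num_normals \<gamma> Q \<ge> 4" "Q \<in> closure D"
    unfolding core_def by blast
  have "bounded D" using bounded_subset[OF bounded_orthotricenters core_component_subset[OF D(2)]] .
  then have "compact (closure D)" by simp
  then show "Q \<in> interior_region \<gamma>"
    using D(1,3) unfolding interior_region_def closed_domains_def by blast
qed

lemma caustic_subset: "caustic \<gamma> - caustic_cusps \<gamma> \<subseteq> orthotricenters \<gamma>"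
proof
  fix Q assume Q: "Q \<in> caustic \<gamma> - caustic_cusps \<gamma>"
  then consider "locally_modelled_on {p. p $ 2 = 0} (caustic \<gamma>) Q"
    | "locally_modelled_on {p. p $ 1 * p $ 2 = 0} (caustic \<gamma>) Q"
    using generic
    unfolding generic_curve_def regular_point_def normal_crossing_def caustic_cusps_def by blast
  then have "three_normals Q" using Q by cases (erule noncusp_three[rotated]; simp)+
  then show "Q \<in> orthotricenters \<gamma>" by (simp add: orthotricenters_iff)
qed

lemma core_minus_caustic: "core \<gamma> - caustic \<gamma> \<subseteq> orthotricenters \<gamma>"
proof
  fix Q assume Q: "Q \<in> core \<gamma> - caustic \<gamma>"
  then have "Q \<in> closure quadricenters"
    using closure_mono[of "quadricenters - caustic \<gamma>" quadricenters]
    unfolding core_eq closure_orthotricenters by blast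
  then have "four_normals Q 1" using four_closure Q by blast
  then show "Q \<in> orthotricenters \<gamma>" using quadricenters_subset by blast
qed

lemma orthotricenters_core:
  "orthotricenters \<gamma> - caustic_cusps \<gamma> = core \<gamma> - caustic_cusps \<gamma>"
proof (rule antisym)
  show "orthotricenters \<gamma> - caustic_cusps \<gamma> \<subseteq> core \<gamma> - caustic_cusps \<gamma>"
    using closure_subset[of "orthotricenters \<gamma>"] unfolding core_eq by blast
  show "core \<gamma> - caustic_cusps \<gamma> \<subseteq> orthotricenters \<gamma> - caustic_cusps \<gamma>"
    using Un_least[OF core_minus_caustic caustic_subset] by blast
qed

end

theorem proposition3:
  fixes \<gamma> :: "real \<Rightarrow> real^2"
  assumes "smooth_closed_curve \<gamma>"
    and "convex_curve \<gamma>"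
    and "\<And>t. curvature \<gamma> t \<noteq> 0"
    and "generic_curve \<gamma>"
  shows "compact (closure (orthotricenters \<gamma>)) \<and>
         closure (orthotricenters \<gamma>) \<subseteq> interior_region \<gamma> \<and>
         closure (orthotricenters \<gamma>) = core \<gamma> \<and>
         orthotricenters \<gamma> - caustic_cusps \<gamma> = core \<gamma> - caustic_cusps \<gamma>"
proof -
  have sm: "smooth_on UNIV \<gamma>" using assms(1) by (simp add: smooth_closed_curve_def)
  obtain T where T: "T > 0" "\<And>s t. \<gamma> s = \<gamma> t \<longleftrightarrow> (\<exists>k::int. t - s = of_int k * T)"
    using assms(1) unfolding smooth_closed_curve_def by blast
  define d1 where "d1 = dir_deriv 1 \<gamma>"
  define d2 where "d2 = dir_deriv 1 d1"
  define d3 where "d3 = dir_deriv 1 d2"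
  have sm1: "smooth_on UNIV d1" and sm2: "smooth_on UNIV d2"
    unfolding d1_def d2_def by (intro smooth_on_deriv(2) sm)+
  have D: "(\<gamma> has_vector_derivative d1 t) (at t)" "(d1 has_vector_derivative d2 t) (at t)"
    "(d2 has_vector_derivative d3 t) (at t)" for t
    using smooth_on_deriv(1)[OF sm] smooth_on_deriv(1)[OF sm1] smooth_on_deriv(1)[OF sm2]
    by (simp_all add: d1_def d2_def d3_def)
  have v: "vector_derivative \<gamma> (at t) = d1 t" "vector_derivative d1 (at t) = d2 t" for t
    using D vector_derivative_at by blast+
  have "rot90 (d1 t) \<bullet> d2 t \<noteq> 0" for t
    using assms(3)[of t] unfolding curvature_def Let_def v by auto
  \<comment> \<open>The nonvanishing numerator of the curvature supplies \<open>nonflat\<close>, and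
    the iterated derivatives of the smooth parametrization supply \<open>d1\<close>,
    \<open>d2\<close>, \<open>d3\<close>.\<close>
  then interpret generic_oval \<gamma> d1 d2 d3 T
    using D T assms(2,4) by unfold_locales
  show ?thesis
    using bounded_orthotricenters core_subset_interior_region core_eq orthotricenters_core by simp
qed

end
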